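(* Let $X_\bullet$ be a persistent space. Then, for any closed interval $[a,b]$ ($a\leq b$ in $\mathbb{R}$), $$\mathbf{cup}(X_\bullet)([a,b])=\max_{[c,d]\supseteq[a,b]}\ \max\left\{\ell\in\mathbb{N}^+\ :\ [c,d]\in\mathrm{barc}\left(\Phi^\ell(X_\bullet)\right)\right\},$$ with the convention that $\max\emptyset=0$.
   Context: A persistent space is a functor $X_\bullet$ from $(\mathbb{R},\leq)$ to the category of compactly generated weak Hausdorff spaces. Cohomology is over a fixed field $K$. Standing assumptions: $X_\bullet$ has a discrete set of critical values and $\mathrm{q}$-tame persistent (co)homology (the maps $\mathbf{H}^p(X_{t'})\to\mathbf{H}^p(X_t)$, $t<t'$, have finite rank), and the persistence modules below decompose into interval modules, so that they have barcodes. All intervals are of one fixed type; they are written as closed intervals $[c,d]$ (possibly with infinite endpoints), but the same statement is intended for bars of the other types (open, half-open), $[c,d]$ then denoting a bar of that type containing $[a,b]$. Maxima that are not attained are read as $\infty$ on both sides. For a graded ring $R$, $\mathbf{len}(R)$ is the largest $\ell\geq0$ such that some product of $\ell$ homogeneous positive-degree elements is nonzero ($0$ if there are no nonzero positive-degree elements). The persistent cup-length invariant is $\mathbf{cup}(X_\bullet)([a,b])=\mathbf{len}(\mathrm{im}(\mathbf{H}^*(X_b)\to\mathbf{H}^*(X_a)))$. Let $\mathbf{H}^+(X)=\bigoplus_{p\geq1}\mathbf{H}^p(X)$, and for $\ell\geq1$ let $(\mathbf{H}^+(X))^\ell$ be the graded subalgebra generated by (equivalently, the linear span of) all $\ell$-fold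 cup products of elements of $\mathbf{H}^+(X)$. The persistent $\ell$-cup module $\Phi^\ell(X_\bullet)$ is the contravariant persistent graded vector space $t\mapsto(\mathbf{H}^+(X_t))^\ell$ with maps induced on cohomology. $\mathrm{barc}(\Phi^\ell(X_\bullet))$ is the disjoint union over $p\geq1$ of the barcodes of its degree-$p$ components, where the barcode of a persistence module isomorphic to a direct sum of interval modules is the multiset of those intervals. *)

theory Defs
  imports "HOL-Homology.Homology" "HOL-Algebra.Module" "HOL-Algebra.QuotRing" "HOL-Analysis.Analysis"
begin

section \<open>Compactly generated weak Hausdorff spaces\<close>

text \<open>
  Both definitions quantify over test maps out of all compact Hausdorff spaces \<open>T\<close>. It suffices to
  let \<open>T\<close> be carried by the type \<open>'a set set\<close>. If \<open>u\<close> maps \<open>T\<close> to \<open>X\<close> and \<open>S \<subseteq> topspace T\<close> meets every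
  nonempty fibre of \<open>u\<close> once, then the closure of \<open>S\<close> in \<open>T\<close> has the same image as \<open>T\<close>, and it has at
  most as many points as there are sets of subsets of \<open>S\<close> (send a point to the traces on \<open>S\<close> of its
  neighbourhoods). In a weak Hausdorff space these images are compact Hausdorff subspaces, and their
  inclusions detect the k-closed sets.
\<close>

definition weak_Hausdorff_space :: "'a topology \<Rightarrow> bool" where
  "weak_Hausdorff_space X \<longleftrightarrow>
     (\<forall>(T :: 'a set set topology) u.
        compact_space T \<and> Hausdorff_space T \<and> continuous_map T X u \<longrightarrow> closedin X (u ` topspace T))"

definition compactly_generated_space :: "'a topology \<Rightarrow> bool" where
  "compactly_generated_space X \<longleftrightarrow>
     (\<forall>A \<subseteq> topspace X.
        (\<forall>(T :: 'a set set topology) u.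
           compact_space T \<and> Hausdorff_space T \<and> continuous_map T X u \<longrightarrow>
             closedin T {z \<in> topspace T. u z \<in> A})
        \<longrightarrow> closedin X A)"


section \<open>Singular cohomology ring with coefficients in a field\<close>

text \<open>
  A cochain assigns to a degree \<open>p\<close> and a singular \<open>p\<close>-simplex an element of \<open>K\<close>; it is an element of
  the direct sum over \<open>p\<close> of the \<open>p\<close>-cochain spaces, so only finitely many degrees are nonzero.
  Values off the singular simplices of \<open>X\<close> are normalised to zero.
\<close>

type_synonym ('k, 'a) cochain = "nat \<Rightarrow> ((nat \<Rightarrow> real) \<Rightarrow> 'a) \<Rightarrow> 'k"

definition cochains :: "('k, 'm) ring_scheme \<Rightarrow> 'a topology \<Rightarrow> ('k, 'a) cochain set" where
  "cochains K X =
     {c. (\<forall>p \<sigma>. c p \<sigma> \<in> carrier K) \<and>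
         (\<forall>p \<sigma>. \<not> singular_simplex p X \<sigma> \<longrightarrow> c p \<sigma> = \<zero>\<^bsub>K\<^esub>) \<and>
         finite {p. c p \<noteq> (\<lambda>\<sigma>. \<zero>\<^bsub>K\<^esub>)}}"

definition coboundary ::
  "('k, 'm) ring_scheme \<Rightarrow> 'a topology \<Rightarrow> ('k, 'a) cochain \<Rightarrow> ('k, 'a) cochain" where
  "coboundary K X c = (\<lambda>n \<sigma>.
     if n > 0 \<and> singular_simplex n X \<sigma>
     then \<Oplus>\<^bsub>K\<^esub>k\<in>{..n}. ((\<ominus>\<^bsub>K\<^esub> \<one>\<^bsub>K\<^esub>) [^]\<^bsub>K\<^esub> k) \<otimes>\<^bsub>K\<^esub> c (n - 1) (singular_face n k \<sigma>)
     else \<zero>\<^bsub>K\<^esub>)"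

text \<open>
  The standard \<open>p\<close>-simplex is a subset of the standard \<open>n\<close>-simplex for \<open>p \<le> n\<close> (the coordinates with
  index above \<open>p\<close> vanish), so the front face is a plain restriction. The back face is spanned by the
  vertices \<open>p, \<dots>, p + q\<close>.
\<close>

definition front_face :: "nat \<Rightarrow> ((nat \<Rightarrow> real) \<Rightarrow> 'a) \<Rightarrow> ((nat \<Rightarrow> real) \<Rightarrow> 'a)" where
  "front_face p \<sigma> = restrict \<sigma> (standard_simplex p)"

definition back_face :: "nat \<Rightarrow> nat \<Rightarrow> ((nat \<Rightarrow> real) \<Rightarrow> 'a) \<Rightarrow> ((nat \<Rightarrow> real) \<Rightarrow> 'a)" where
  "back_face p q \<sigma> = restrict (\<lambda>x. \<sigma> (\<lambda>i. if i < p then 0 else x (i - p))) (standard_simplex q)"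

definition cup_product ::
  "('k, 'm) ring_scheme \<Rightarrow> 'a topology \<Rightarrow> ('k, 'a) cochain \<Rightarrow> ('k, 'a) cochain \<Rightarrow> ('k, 'a) cochain" where
  "cup_product K X c d = (\<lambda>n \<sigma>.
     if singular_simplex n X \<sigma>
     then \<Oplus>\<^bsub>K\<^esub>p\<in>{..n}. c p (front_face p \<sigma>) \<otimes>\<^bsub>K\<^esub> d (n - p) (back_face p (n - p) \<sigma>)
     else \<zero>\<^bsub>K\<^esub>)"

definition cochain_ring :: "('k, 'm) ring_scheme \<Rightarrow> 'a topology \<Rightarrow> ('k, 'a) cochain ring" where
  "cochain_ring K X =
     \<lparr>carrier = cochains K X,
      monoid.mult = cup_product K X,
      one = (\<lambda>p \<sigma>. if p = 0 \<and> singular_simplex 0 X \<sigma> then \<one>\<^bsub>K\<^esub> else \<zero>\<^bsub>K\<^esub>),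
      zero = (\<lambda>p \<sigma>. \<zero>\<^bsub>K\<^esub>),
      add = (\<lambda>c d p \<sigma>. c p \<sigma> \<oplus>\<^bsub>K\<^esub> d p \<sigma>)\<rparr>"

definition cocycles :: "('k, 'm) ring_scheme \<Rightarrow> 'a topology \<Rightarrow> ('k, 'a) cochain set" where
  "cocycles K X = {z \<in> cochains K X. coboundary K X z = (\<lambda>p \<sigma>. \<zero>\<^bsub>K\<^esub>)}"

definition coboundaries :: "('k, 'm) ring_scheme \<Rightarrow> 'a topology \<Rightarrow> ('k, 'a) cochain set" where
  "coboundaries K X = coboundary K X ` cochains K X"

definition cocycle_ring :: "('k, 'm) ring_scheme \<Rightarrow> 'a topology \<Rightarrow> ('k, 'a) cochain ring" where
  "cocycle_ring K X = (cochain_ring K X)\<lparr>carrier := cocycles K X\<rparr>"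

text \<open>
  The graded \<open>K\<close>-algebra of cohomology classes: the quotient of the ring of cocycles by the ideal of
  coboundaries. Adding the coboundaries in the scalar product makes the result a full coset also for
  the scalar zero.
\<close>

definition cohomology ::
  "('k, 'm) ring_scheme \<Rightarrow> 'a topology \<Rightarrow> ('k, ('k, 'a) cochain set) module" where
  "cohomology K X =
     ring.extend (cocycle_ring K X Quot coboundaries K X)
       (module.fields (\<lambda>r A. coboundaries K X <+>\<^bsub>cocycle_ring K X\<^esub> (\<lambda>z p \<sigma>. r \<otimes>\<^bsub>K\<^esub> z p \<sigma>) ` A))"

definition cohomology_deg ::
  "('k, 'm) ring_scheme \<Rightarrow> nat \<Rightarrow> 'a topology \<Rightarrow> ('k, 'a) cochain set set" where
  "cohomology_deg K p X =
     {coboundaries K X +>\<^bsub>cocycle_ring K X\<^esub> z |z.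
        z \<in> cocycles K X \<and> (\<forall>q. q \<noteq> p \<longrightarrow> z q = (\<lambda>\<sigma>. \<zero>\<^bsub>K\<^esub>))}"

definition cochain_map ::
  "('k, 'm) ring_scheme \<Rightarrow> 'a topology \<Rightarrow> ('a \<Rightarrow> 'b) \<Rightarrow> ('k, 'b) cochain \<Rightarrow> ('k, 'a) cochain" where
  "cochain_map K X g c =
     (\<lambda>p \<sigma>. if singular_simplex p X \<sigma> then c p (simplex_map p g \<sigma>) else \<zero>\<^bsub>K\<^esub>)"

definition cohomology_map ::
  "('k, 'm) ring_scheme \<Rightarrow> 'a topology \<Rightarrow> ('a \<Rightarrow> 'b) \<Rightarrow>
     ('k, 'b) cochain set \<Rightarrow> ('k, 'a) cochain set" where
  "cohomology_map K X g A = coboundaries K X <+>\<^bsub>cocycle_ring K X\<^esub> cochain_map K X g ` A"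


section \<open>Linear spans, products, and length of a graded ring\<close>

definition lspan :: "('k, 'm) ring_scheme \<Rightarrow> ('k, 'v, 'n) module_scheme \<Rightarrow> 'v set \<Rightarrow> 'v set" where
  "lspan K M S = \<Inter>{W. submodule W K M \<and> S \<subseteq> W}"

definition list_product :: "('v, 'n) ring_scheme \<Rightarrow> 'v list \<Rightarrow> 'v" where
  "list_product R xs = foldr (\<otimes>\<^bsub>R\<^esub>) xs \<one>\<^bsub>R\<^esub>"

text \<open>
  \<open>G p\<close> is the degree-\<open>p\<close> part of \<open>R\<close>. In \<^typ>\<open>enat\<close>, the supremum of a finite nonempty set is its
  maximum, that of the empty set is \<open>0\<close> and that of an infinite set is \<open>\<infinity>\<close>.
\<close>

definition graded_len :: "('v, 'n) ring_scheme \<Rightarrow> (nat \<Rightarrow> 'v set) \<Rightarrow> enat" where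
  "graded_len R G =
     Sup {enat l |l. \<exists>xs. length xs = l \<and> set xs \<subseteq> (\<Union>p\<in>{1..}. G p) \<and> list_product R xs \<noteq> \<zero>\<^bsub>R\<^esub>}"


section \<open>Persistent spaces\<close>

record 'a pspace =
  Space :: "real \<Rightarrow> 'a topology"
  Map :: "real \<Rightarrow> real \<Rightarrow> 'a \<Rightarrow> 'a"

text \<open>\<open>Map X s t\<close> is the structure map from \<open>Space X s\<close> to \<open>Space X t\<close>, relevant for \<open>s \<le> t\<close> only.\<close>

definition persistent_space :: "'a pspace \<Rightarrow> bool" where
  "persistent_space X \<longleftrightarrow>
     (\<forall>t. compactly_generated_space (Space X t) \<and> weak_Hausdorff_space (Space X t)) \<and>
     (\<forall>s t. s \<le> t \<longrightarrow> continuous_map (Space X s) (Space X t) (Map X s t)) \<and>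
     (\<forall>t. \<forall>x \<in> topspace (Space X t). Map X t t x = x) \<and>
     (\<forall>r s t. r \<le> s \<and> s \<le> t \<longrightarrow>
        (\<forall>x \<in> topspace (Space X r). Map X s t (Map X r s x) = Map X r t x))"

abbreviation pcohomology_map ::
  "('k, 'm) ring_scheme \<Rightarrow> 'a pspace \<Rightarrow> real \<Rightarrow> real \<Rightarrow>
     ('k, 'a) cochain set \<Rightarrow> ('k, 'a) cochain set" where
  "pcohomology_map K X s t \<equiv> cohomology_map K (Space X s) (Map X s t)"

text \<open>
  A value is regular if the persistent cohomology is constant near it, and critical otherwise. A value
  near which all structure maps are homeomorphisms or homotopy equivalences is regular, so the critical
  values defined through those maps include the ones defined here; discreteness is assumed for the
  smaller set. The set is closed, so discreteness makes it locally finite.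
\<close>

definition regular_value :: "('k, 'm) ring_scheme \<Rightarrow> 'a pspace \<Rightarrow> real \<Rightarrow> bool" where
  "regular_value K X t \<longleftrightarrow>
     (\<exists>e>0. \<forall>s s'. t - e < s \<and> s \<le> s' \<and> s' < t + e \<longrightarrow>
        bij_betw (pcohomology_map K X s s')
          (carrier (cohomology K (Space X s'))) (carrier (cohomology K (Space X s))))"

definition critical_values :: "('k, 'm) ring_scheme \<Rightarrow> 'a pspace \<Rightarrow> real set" where
  "critical_values K X = {t. \<not> regular_value K X t}"

definition q_tame :: "('k, 'm) ring_scheme \<Rightarrow> 'a pspace \<Rightarrow> bool" where
  "q_tame K X \<longleftrightarrow>
     (\<forall>p t t'. t < t' \<longrightarrow>
        (\<exists>S. finite S \<and> S \<subseteq> pcohomology_map K X t t' ` cohomology_deg K p (Space X t') \<and>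
             pcohomology_map K X t t' ` cohomology_deg K p (Space X t')
               = lspan K (cohomology K (Space X t)) S))"

text \<open>\<open>pcup_length K X a b\<close> is the value of the persistent cup-length invariant at \<open>[a,b]\<close>.\<close>

definition pcup_length :: "('k, 'm) ring_scheme \<Rightarrow> 'a pspace \<Rightarrow> real \<Rightarrow> real \<Rightarrow> enat" where
  "pcup_length K X a b =
     (let im = pcohomology_map K X a b ` carrier (cohomology K (Space X b))
      in graded_len ((cohomology K (Space X a))\<lparr>carrier := im\<rparr>)
           (\<lambda>p. im \<inter> cohomology_deg K p (Space X a)))"


section \<open>Persistence modules and barcodes\<close>

text \<open>Contravariant persistence modules: \<open>Restr M s t\<close> maps \<open>Fib M t\<close> to \<open>Fib M s\<close> for \<open>s \<le> t\<close>.\<close>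

record ('k, 'v) pmodule =
  Fib :: "real \<Rightarrow> ('k, 'v) module"
  Restr :: "real \<Rightarrow> real \<Rightarrow> 'v \<Rightarrow> 'v"

definition pmodule_iso ::
  "('k, 'm) ring_scheme \<Rightarrow> ('k, 'v) pmodule \<Rightarrow> ('k, 'w) pmodule \<Rightarrow> bool" where
  "pmodule_iso K M N \<longleftrightarrow>
     (\<exists>\<theta>. (\<forall>t. \<theta> t \<in> iso (add_monoid (Fib M t)) (add_monoid (Fib N t)) \<and>
               (\<forall>r \<in> carrier K. \<forall>x \<in> carrier (Fib M t).
                  \<theta> t (r \<odot>\<^bsub>Fib M t\<^esub> x) = r \<odot>\<^bsub>Fib N t\<^esub> \<theta> t x)) \<and>
          (\<forall>s t. s \<le> t \<longrightarrow>
               (\<forall>x \<in> carrier (Fib M t). \<theta> s (Restr M s t x) = Restr N s t (\<theta> t x))))"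

text \<open>
  A multiset of intervals, possibly infinite and with possibly infinite multiplicities, is a set of
  pairs of a label and an interval; the multiplicity of \<open>I\<close> is the number of labels it is paired with.
  For such a multiset \<open>B\<close>, \<open>interval_sum K B\<close> is the direct sum over \<open>(i, I) \<in> B\<close> of the interval
  modules with value \<open>K\<close> on \<open>I\<close>, identities as structure maps inside \<open>I\<close>, and zero elsewhere. Its
  elements at \<open>t\<close> are finitely supported families of scalars. The ring multiplication and unit of the
  fibres play no role.
\<close>

type_synonym 'i bars = "('i \<times> real set) set"

definition interval_sum :: "('k, 'm) ring_scheme \<Rightarrow> 'i bars \<Rightarrow> ('k, 'i \<times> real set \<Rightarrow> 'k) pmodule" where
  "interval_sum K B =
     \<lparr>Fib = (\<lambda>t.
        \<lparr>carrier = {x. (\<forall>j. x j \<in> carrier K) \<and> finite {j. x j \<noteq> \<zero>\<^bsub>K\<^esub>} \<and>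
                       (\<forall>j. x j \<noteq> \<zero>\<^bsub>K\<^esub> \<longrightarrow> j \<in> B \<and> t \<in> snd j)},
         monoid.mult = undefined, one = undefined,
         zero = (\<lambda>j. \<zero>\<^bsub>K\<^esub>),
         add = (\<lambda>x y j. x j \<oplus>\<^bsub>K\<^esub> y j),
         module.smult = (\<lambda>r x j. r \<otimes>\<^bsub>K\<^esub> x j)\<rparr>),
      Restr = (\<lambda>s t x j. if s \<in> snd j \<and> t \<in> snd j then x j else \<zero>\<^bsub>K\<^esub>)\<rparr>"

text \<open>
  \<open>is_barcode K M B\<close>: the multiset \<open>B\<close> is the barcode of \<open>M\<close>. Such a \<open>B\<close> exists precisely if \<open>M\<close> is
  isomorphic to a direct sum of interval modules, and it is then unique up to relabelling.
\<close>

definition is_barcode :: "('k, 'm) ring_scheme \<Rightarrow> ('k, 'v) pmodule \<Rightarrow> 'i bars \<Rightarrow> bool" where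
  "is_barcode K M B \<longleftrightarrow>
     (\<forall>(i, I) \<in> B. is_interval I \<and> I \<noteq> {}) \<and> pmodule_iso K M (interval_sum K B)"

text \<open>For a persistent graded vector space: the disjoint union over all positive degrees.\<close>

definition is_graded_barcode ::
  "('k, 'm) ring_scheme \<Rightarrow> (nat \<Rightarrow> ('k, 'v) pmodule) \<Rightarrow> (nat \<times> 'i) bars \<Rightarrow> bool" where
  "is_graded_barcode K M B \<longleftrightarrow>
     (\<exists>b. (\<forall>p\<ge>1. is_barcode K (M p) (b p)) \<and> B = {((p, i), I) |p i I. p \<ge> 1 \<and> (i, I) \<in> b p})"

text \<open>
  A bar of each type with given endpoints, as a set of real numbers: an infinite endpoint of a closed
  or half-open bar is never an element of it.
\<close>

datatype bar_type = Closed | Open | Left_Closed | Right_Closed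

fun bar :: "bar_type \<Rightarrow> ereal \<Rightarrow> ereal \<Rightarrow> real set" where
  "bar Closed c d = ereal -` {c..d}"
| "bar Open c d = ereal -` {c<..<d}"
| "bar Left_Closed c d = ereal -` {c..<d}"
| "bar Right_Closed c d = ereal -` {c<..d}"


section \<open>Persistent cup modules\<close>

definition cohomology_pos ::
  "('k, 'm) ring_scheme \<Rightarrow> 'a topology \<Rightarrow> ('k, 'a) cochain set set" where
  "cohomology_pos K X = lspan K (cohomology K X) (\<Union>p\<in>{1..}. cohomology_deg K p X)"

definition cohomology_pos_power ::
  "('k, 'm) ring_scheme \<Rightarrow> nat \<Rightarrow> 'a topology \<Rightarrow> ('k, 'a) cochain set set" where
  "cohomology_pos_power K l X =
     lspan K (cohomology K X)
       {list_product (cohomology K X) xs |xs. length xs = l \<and> set xs \<subseteq> cohomology_pos K X}"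

text \<open>\<open>cup_module K X l p\<close> is the degree-\<open>p\<close> component of the persistent \<open>l\<close>-cup module.\<close>

definition cup_module ::
  "('k, 'm) ring_scheme \<Rightarrow> 'a pspace \<Rightarrow> nat \<Rightarrow> nat \<Rightarrow> ('k, ('k, 'a) cochain set) pmodule" where
  "cup_module K X l p =
     \<lparr>Fib = (\<lambda>t. (cohomology K (Space X t))
               \<lparr>carrier := cohomology_pos_power K l (Space X t) \<inter> cohomology_deg K p (Space X t)\<rparr>),
      Restr = pcohomology_map K X\<rparr>"

end

theory Submission
  imports Defs "HOL-Algebra.Subrings"
begin

text \<open>
  Both sides are the supremum of the lengths \<open>l\<close> for which some product of \<open>l\<close> homogeneous classes of
  positive degree in the cohomology of \<open>X\<^sub>b\<close> has nonzero image in that of \<open>X\<^sub>a\<close>. For the cup-length this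
  holds because the restriction map is a ring homomorphism and a homogeneous element of its image has
  a homogeneous preimage. For the barcode, a bar of \<open>\<Phi>\<^sup>l\<close> contains \<open>[a, b]\<close> exactly if the structure map
  of \<open>\<Phi>\<^sup>l\<close> from \<open>b\<close> to \<open>a\<close> is nonzero, and by multilinearity this happens exactly if it is nonzero on some
  product of homogeneous classes. The cup product descends to cohomology by the Leibniz rule for
  the coboundary.
\<close>

section \<open>Front and back faces\<close>

text \<open>Cohomology classes are handled through cocycle representatives, since associativity, the
  unit laws and naturality of the cup product hold strictly for cochains; they reduce to the way in
  which cutting a simplex at one vertex and deleting another interact. Degrees are settled on
  cochains as well: projection to degree \<open>p\<close> carries coboundaries to coboundaries and
  commutes with induced maps, so projecting a representative makes a preimage homogeneous. On the
  barcode side the obstacle is that \<open>cohomology_pos_power\<close> is spanned by products of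
  arbitrary sums of positive-degree classes; vanishing on products of homogeneous classes is spread
  to it one factor at a time, through kernels. A product of \<open>l\<close> homogeneous
  positive-degree classes with \<open>l\<close> at least 1 lies in a single degree at least
  \<open>l\<close>, hence in a component that the graded barcode records. In a sum of interval
  modules the structure map keeps exactly the coordinates whose bars contain both endpoints, and
  intervals are convex. Length 0 is harmless: it contributes 0 to a supremum in \<open>enat\<close>,
  the value of an empty one.\<close>

definition shift :: "nat \<Rightarrow> (nat \<Rightarrow> real) \<Rightarrow> nat \<Rightarrow> real" where
  "shift p x = (\<lambda>i. if i < p then 0 else x (i - p))"

lemma shift_0 [simp]: "shift 0 x = x"
  by (simp add: shift_def)

text \<open>\<open>shift p\<close> embeds a simplex as the face spanned by the vertices from
  \<open>p\<close> on. The recursion presents it as an iterated zeroth face inclusion, through which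
  facts about \<open>simplical_face\<close> carry over.\<close>

lemma shift_Suc: "shift (Suc p) x = simplical_face 0 (shift p x)"
  by (auto simp: shift_def simplical_face_def fun_eq_iff)

lemma shift_shift: "shift p (shift q x) = shift (p + q) x"
  by (auto simp: shift_def fun_eq_iff)

lemma shift_in_standard_simplex: "x \<in> standard_simplex q \<Longrightarrow> shift p x \<in> standard_simplex (p + q)"
proof (induction p)
  case (Suc p)
  then show ?case
    using simplical_face_in_standard_simplex[of "Suc (p + q)" 0 "shift p x"] by (simp add: shift_Suc)
qed simp

lemma standard_simplex_le: "x \<in> standard_simplex p \<Longrightarrow> p \<le> n \<Longrightarrow> x \<in> standard_simplex n"
  using standard_simplex_mono by blast

lemma simplical_face_in_standard_simplex_Suc:
  "x \<in> standard_simplex p \<Longrightarrow> k \<le> Suc p \<Longrightarrow> simplical_face k x \<in> standard_simplex (Suc p)"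
  using simplical_face_in_standard_simplex[of "Suc p" k x] by simp

text \<open>The coordinates above \<open>p\<close> already vanish, so inserting one more zero there
  changes nothing. This is what lets a front face be a plain restriction.\<close>

lemma simplical_face_beyond:
  assumes "x \<in> standard_simplex p" "p < k"
  shows "simplical_face k x = x"
  using assms by (auto simp: standard_simplex_def simplical_face_def fun_eq_iff)

text \<open>A zero inserted among, or right behind, the leading zeros only lengthens them by one; a
  zero inserted further back belongs to the argument of \<open>shift\<close>, as the next lemma
  records.\<close>

lemma simplical_face_shift_le: "k \<le> p \<Longrightarrow> simplical_face k (shift p x) = shift (Suc p) x"
  by (auto simp: simplical_face_def shift_def fun_eq_iff)

lemma simplical_face_shift_ge: "simplical_face (p + k) (shift p x) = shift p (simplical_face k x)"
  by (auto simp: simplical_face_def shift_def fun_eq_iff intro!: arg_cong[where f = x])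

lemma singular_face_eq:
  "singular_face (Suc n) k \<sigma> = restrict (\<lambda>x. \<sigma> (simplical_face k x)) (standard_simplex n)"
  by (simp add: singular_face_def o_def)

lemma back_face_eq: "back_face p q \<sigma> = restrict (\<lambda>x. \<sigma> (shift p x)) (standard_simplex q)"
  by (simp add: back_face_def shift_def)

lemma front_face_eq: "front_face p \<sigma> = restrict (\<lambda>x. \<sigma> x) (standard_simplex p)"
  by (simp add: front_face_def)

lemmas face_eqs = singular_face_eq back_face_eq front_face_eq

lemma front_face_self: "singular_simplex n X \<sigma> \<Longrightarrow> front_face n \<sigma> = \<sigma>"
  by (simp add: front_face_def singular_simplex_def extensional_restrict)

lemma back_face_0: "singular_simplex n X \<sigma> \<Longrightarrow> back_face 0 n \<sigma> = \<sigma>"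
  by (simp add: back_face_eq singular_simplex_def extensional_restrict)

text \<open>
  Front and back faces are iterated singular faces, which gives their continuity.
\<close>

lemma front_face_eq_singular_face:
  "front_face p \<sigma> = singular_face (Suc p) (Suc p) (front_face (Suc p) \<sigma>)"
  by (auto simp: face_eqs simplical_face_beyond standard_simplex_le)

lemma back_face_Suc: "back_face (Suc p) q \<sigma> = singular_face (Suc q) 0 (back_face p (Suc q) \<sigma>)"
  by (auto simp: face_eqs simplical_face_in_standard_simplex_Suc simp flip: simplical_face_shift_ge
        intro!: restrict_ext) (simp add: simplical_face_shift_le)

lemma singular_simplex_singular_face_Suc:
  "singular_simplex (Suc n) X \<sigma> \<Longrightarrow> k \<le> Suc n \<Longrightarrow> singular_simplex n X (singular_face (Suc n) k \<sigma>)"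
  using singular_simplex_singular_face[of "Suc n"] by simp

text \<open>Downward induction from \<open>n\<close>, dropping the last vertex at each step.\<close>

lemma singular_simplex_front_face:
  assumes "singular_simplex n X \<sigma>" "p \<le> n"
  shows "singular_simplex p X (front_face p \<sigma>)"
  using assms(2)
proof (induction rule: inc_induct)
  case base
  then show ?case using assms(1) by (simp add: front_face_self)
next
  case (step p)
  then show ?case
    by (subst front_face_eq_singular_face) (simp add: singular_simplex_singular_face_Suc)
qed

lemma singular_simplex_back_face:
  "singular_simplex (p + q) X \<sigma> \<Longrightarrow> singular_simplex q X (back_face p q \<sigma>)"
proof (induction p arbitrary: q)
  case 0
  then show ?case by (simp add: back_face_0)
next
  case (Suc p)
  then show ?case by (simp add: back_face_Suc singular_simplex_singular_face_Suc)
qed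

text \<open>This and the next three rules are the bookkeeping of the Leibniz rule: deleting vertex
  \<open>k\<close> before cutting at \<open>p\<close> deletes a vertex either of the front part or
  of the back part and leaves the other part alone.\<close>

lemma front_face_singular_face_gt:
  assumes "p < k" "p \<le> n"
  shows "front_face p (singular_face (Suc n) k \<sigma>) = front_face p \<sigma>"
  using assms by (auto simp: face_eqs simplical_face_beyond standard_simplex_le)

lemma front_face_singular_face_le:
  assumes "k \<le> Suc p" "p \<le> n"
  shows "front_face p (singular_face (Suc n) k \<sigma>) = singular_face (Suc p) k (front_face (Suc p) \<sigma>)"
  using assms
  by (auto simp: face_eqs standard_simplex_le simplical_face_in_standard_simplex_Suc
      intro!: restrict_ext)

lemma back_face_singular_face_le:
  assumes "k \<le> p"
  shows "back_face p q (singular_face (Suc (p + q)) k \<sigma>) = back_face (Suc p) q \<sigma>"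
  using assms
  by (auto simp: face_eqs shift_in_standard_simplex simplical_face_shift_le intro!: restrict_ext)

lemma back_face_singular_face_ge:
  assumes "k \<le> Suc q"
  shows "back_face p q (singular_face (Suc (p + q)) (p + k) \<sigma>) =
    singular_face (Suc q) k (back_face p (Suc q) \<sigma>)"
  using assms
  by (auto simp: face_eqs shift_in_standard_simplex simplical_face_shift_ge
      simplical_face_in_standard_simplex_Suc intro!: restrict_ext)

text \<open>With the next two rules, both bracketings of a triple cup product are evaluated on the
  same front, middle and back faces.\<close>

lemma front_face_front_face: "p \<le> m \<Longrightarrow> front_face p (front_face m \<sigma>) = front_face p \<sigma>"
  by (auto simp: face_eqs standard_simplex_le intro!: restrict_ext)

lemma back_face_front_face:
  "back_face p q (front_face (p + q) \<sigma>) = front_face q (back_face p (q + r) \<sigma>)"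
  by (auto simp: face_eqs standard_simplex_le shift_in_standard_simplex intro!: restrict_ext)

lemma back_face_back_face: "back_face q r (back_face p (q + r) \<sigma>) = back_face (p + q) r \<sigma>"
  by (auto simp: face_eqs shift_shift shift_in_standard_simplex intro!: restrict_ext)

text \<open>The simplicial identity, indexed so that the pairs (\<open>i\<close>, \<open>j\<close>)
  and (\<open>Suc j\<close>, \<open>i\<close>) match up in the proof that the coboundary squares to
  zero.\<close>

lemma singular_face_singular_face:
  assumes "i \<le> j" "j \<le> Suc n"
  shows "singular_face (Suc n) i (singular_face (Suc (Suc n)) (Suc j) \<sigma>) =
    singular_face (Suc n) j (singular_face (Suc (Suc n)) i \<sigma>)"
proof -
  have "simplical_face (Suc j) (simplical_face i x) = simplical_face i (simplical_face j x)"
    for x :: "nat \<Rightarrow> real"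
    using assms(1) by (auto simp: simplical_face_def fun_eq_iff)
  then show ?thesis
    using assms by (auto simp: face_eqs simplical_face_in_standard_simplex_Suc intro!: restrict_ext)
qed

lemma front_face_simplex_map:
  "p \<le> n \<Longrightarrow> front_face p (simplex_map n g \<sigma>) = simplex_map p g (front_face p \<sigma>)"
  by (auto simp: face_eqs simplex_map_def standard_simplex_le intro!: restrict_ext)

lemma back_face_simplex_map:
  "back_face p q (simplex_map (p + q) g \<sigma>) = simplex_map q g (back_face p q \<sigma>)"
  by (auto simp: face_eqs simplex_map_def shift_in_standard_simplex intro!: restrict_ext)

lemma singular_face_simplex_map_Suc:
  "k \<le> Suc n \<Longrightarrow>
    singular_face (Suc n) k (simplex_map (Suc n) g \<sigma>) = simplex_map n g (singular_face (Suc n) k \<sigma>)"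
  by (auto simp: face_eqs simplex_map_def simplical_face_in_standard_simplex_Suc intro!: restrict_ext)

section \<open>The cochain algebra\<close>

text \<open>Both sides add up \<open>f p q\<close> over the triangle p + q \<le> n, by diagonals on
  the left and by rows on the right. For a triple cup product these are the two bracketings.\<close>

lemma (in abelian_monoid) finsum_triangle:
  fixes f :: "nat \<Rightarrow> nat \<Rightarrow> 'a"
  assumes "\<And>p q. f p q \<in> carrier G"
  shows "(\<Oplus>m\<in>{..n}. \<Oplus>p\<in>{..m}. f p (m - p)) = (\<Oplus>p\<in>{..n}. \<Oplus>q\<in>{..n - p}. f p q)"
proof (induction n)
  case 0
  then show ?case using assms by (simp add: Pi_def)
next
  case (Suc n)
  have "(\<Oplus>p\<in>{..Suc n}. \<Oplus>q\<in>{..Suc n - p}. f p q) =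
      f (Suc n) 0 \<oplus> (\<Oplus>p\<in>{..n}. \<Oplus>q\<in>{..Suc n - p}. f p q)"
    using assms by (simp add: Pi_def)
  \<comment> \<open>Each old row gains the entry \<open>f p (Suc n - p)\<close>; together with the
    corner \<open>f (Suc n) 0\<close> these entries form the new diagonal.\<close>
  also have "(\<Oplus>p\<in>{..n}. \<Oplus>q\<in>{..Suc n - p}. f p q) =
      (\<Oplus>p\<in>{..n}. f p (Suc n - p) \<oplus> (\<Oplus>q\<in>{..n - p}. f p q))"
    using assms by (intro finsum_cong') (auto simp: Suc_diff_le)
  also have "\<dots> = (\<Oplus>p\<in>{..n}. f p (Suc n - p)) \<oplus> (\<Oplus>m\<in>{..n}. \<Oplus>p\<in>{..m}. f p (m - p))"
    using assms Suc by (subst finsum_addf) auto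
  finally show ?case using assms by (simp add: Pi_def a_assoc)
qed

text \<open>The map from (\<open>i\<close>, \<open>j\<close>) to (\<open>Suc j\<close>,
  \<open>i\<close>) is a bijection from the entries with first index at most the second onto the
  remaining ones, and matched entries cancel. The induction adds one column and one row.\<close>

lemma (in abelian_monoid) finsum_simplicial_cancel:
  fixes f :: "nat \<Rightarrow> nat \<Rightarrow> 'a"
  assumes f: "\<And>k i. f k i \<in> carrier G"
    and cancel: "\<And>i j. i \<le> j \<Longrightarrow> j \<le> n \<Longrightarrow> f i j \<oplus> f (Suc j) i = \<zero>"
  shows "(\<Oplus>k\<in>{..Suc n}. \<Oplus>i\<in>{..n}. f k i) = \<zero>"
  using cancel
proof (induction n)
  case 0
  have "f 0 0 \<oplus> f (Suc 0) 0 = \<zero>" using 0 by blast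
  then show ?case using f by (simp add: Pi_def a_comm)
next
  case (Suc n)
  have "(\<Oplus>k\<in>{..Suc (Suc n)}. \<Oplus>i\<in>{..Suc n}. f k i) =
    (\<Oplus>k\<in>{..Suc (Suc n)}. f k (Suc n)) \<oplus> (\<Oplus>k\<in>{..Suc (Suc n)}. \<Oplus>i\<in>{..n}. f k i)"
    using f by (simp only: finsum_Suc[of "f _"] finsum_addf finsum_closed Pi_iff simp_thms ball_triv)
  \<comment> \<open>The corner entry \<open>f (Suc (Suc n)) (Suc n)\<close> is moved from the column
    to the row, so that both have the same length and cancel term by term.\<close>
  also have "\<dots> = ((\<Oplus>k\<in>{..Suc n}. f k (Suc n)) \<oplus> (\<Oplus>i\<in>{..Suc n}. f (Suc (Suc n)) i))
      \<oplus> (\<Oplus>k\<in>{..Suc n}. \<Oplus>i\<in>{..n}. f k i)"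
    using f by (simp add: Pi_def a_ac del: finsum_Suc
        add: finsum_Suc[of _ "Suc n"] finsum_Suc[of "f (Suc (Suc n))" n])
  also have "(\<Oplus>k\<in>{..Suc n}. f k (Suc n)) \<oplus> (\<Oplus>i\<in>{..Suc n}. f (Suc (Suc n)) i) =
      (\<Oplus>i\<in>{..Suc n}. f i (Suc n) \<oplus> f (Suc (Suc n)) i)"
    using f by (subst finsum_addf) auto
  also have "\<dots> = (\<Oplus>i\<in>{..Suc n}. \<zero>)"
    using Suc.prems f by (intro finsum_cong') auto
  also have "(\<Oplus>k\<in>{..Suc n}. \<Oplus>i\<in>{..n}. f k i) = \<zero>"
    using Suc by simp
  finally show ?case by (simp add: finsum_zero)
qed

lemma (in abelian_monoid) finsum_split_at:
  fixes f :: "nat \<Rightarrow> 'a"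
  assumes "\<And>k. f k \<in> carrier G"
  shows "(\<Oplus>k\<in>{..p + Suc r}. f k) = (\<Oplus>k\<in>{..p}. f k) \<oplus> (\<Oplus>j\<in>{..r}. f (p + Suc j))"
  using assms by (induction r) (simp_all add: Pi_def a_ac)

lemma (in abelian_monoid) finsum_swap:
  assumes "finite A" "finite B" "\<And>i j. f i j \<in> carrier G"
  shows "(\<Oplus>i\<in>A. \<Oplus>j\<in>B. f i j) = (\<Oplus>j\<in>B. \<Oplus>i\<in>A. f i j)"
  using assms(1)
proof (induction A rule: finite_induct)
  case empty
  then show ?case by (simp add: finsum_zero)
next
  case (insert a A)
  then show ?case using assms(2,3) by (simp add: Pi_def finsum_addf)
qed

lemma (in abelian_monoid) finsum_nonzeroE:
  assumes "finsum G f A \<noteq> \<zero>"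
  obtains x where "x \<in> A" "f x \<noteq> \<zero>"
  using assms add.finprod_one_eqI[of A f] by blast

section \<open>Signs and membership in the cochain space\<close>

locale cochain_algebra = cring K for K :: "('k, 'm) ring_scheme" (structure)
begin

definition sgn_pow :: "nat \<Rightarrow> 'k" where
  "sgn_pow k = (\<ominus> \<one>) [^] k"

lemma sgn_pow_closed [simp]: "sgn_pow k \<in> carrier K"
  by (simp add: sgn_pow_def)

lemma sgn_pow_0 [simp]: "sgn_pow 0 = \<one>"
  by (simp add: sgn_pow_def)

lemma sgn_pow_Suc: "sgn_pow (Suc k) = \<ominus> sgn_pow k"
  by (simp add: sgn_pow_def r_minus)

lemma sgn_pow_add: "sgn_pow (p + q) = sgn_pow p \<otimes> sgn_pow q"
  by (simp add: sgn_pow_def nat_pow_mult)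

lemma sgn_pow_square: "sgn_pow k \<otimes> sgn_pow k = \<one>"
  by (induction k) (simp_all add: sgn_pow_Suc l_minus r_minus)

lemma cochain_closed: "c \<in> cochains K X \<Longrightarrow> c p \<sigma> \<in> carrier K"
  by (simp add: cochains_def)

lemma cochain_off_simplex: "c \<in> cochains K X \<Longrightarrow> \<not> singular_simplex p X \<sigma> \<Longrightarrow> c p \<sigma> = \<zero>"
  by (simp add: cochains_def)

text \<open>Finiteness of the support is checked against any finite superset \<open>A\<close>, so
  the degrees of sums, products and coboundaries need not be determined exactly.\<close>

lemma cochainI:
  assumes "\<And>p \<sigma>. c p \<sigma> \<in> carrier K" "\<And>p \<sigma>. \<not> singular_simplex p X \<sigma> \<Longrightarrow> c p \<sigma> = \<zero>"
    and "finite A" "\<And>p \<sigma>. c p \<sigma> \<noteq> \<zero> \<Longrightarrow> p \<in> A"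
  shows "c \<in> cochains K X"
proof -
  have "{p. c p \<noteq> (\<lambda>\<sigma>. \<zero>)} \<subseteq> A"
    using assms(4) by (auto simp: fun_eq_iff)
  then show ?thesis
    using assms finite_subset by (auto simp: cochains_def)
qed

lemma cochain_support:
  assumes "c \<in> cochains K X"
  obtains A where "finite A" "\<And>p \<sigma>. c p \<sigma> \<noteq> \<zero> \<Longrightarrow> p \<in> A"
  using assms by (intro that[of "{p. c p \<noteq> (\<lambda>\<sigma>. \<zero>)}"]) (auto simp: cochains_def)

lemma zero_cochain: "(\<lambda>p \<sigma>. \<zero>) \<in> cochains K X"
  by (rule cochainI[of _ _ "{}"]) auto

lemma unit_cochain:
  "(\<lambda>p \<sigma>. if p = 0 \<and> singular_simplex 0 X \<sigma> then \<one> else \<zero>) \<in> cochains K X"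
  by (rule cochainI[of _ _ "{0}"]) (auto split: if_splits)

lemma add_cochain:
  assumes "c \<in> cochains K X" "d \<in> cochains K X"
  shows "(\<lambda>p \<sigma>. c p \<sigma> \<oplus> d p \<sigma>) \<in> cochains K X"
proof -
  obtain A B where "finite A" "\<And>p \<sigma>. c p \<sigma> \<noteq> \<zero> \<Longrightarrow> p \<in> A" "finite B" "\<And>p \<sigma>. d p \<sigma> \<noteq> \<zero> \<Longrightarrow> p \<in> B"
    using assms cochain_support by metis
  then show ?thesis
    using assms by (intro cochainI[of _ _ "A \<union> B"]) (auto simp: cochain_closed cochain_off_simplex, metis l_zero zero_closed)
qed

text \<open>The factor may vary with the degree, which covers scalar multiples as well as the
  Leibniz sign \<open>twist\<close>.\<close>

lemma scale_cochain:
  assumes "c \<in> cochains K X" "\<And>p. r p \<in> carrier K"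
  shows "(\<lambda>p \<sigma>. r p \<otimes> c p \<sigma>) \<in> cochains K X"
proof -
  obtain A where "finite A" "\<And>p \<sigma>. c p \<sigma> \<noteq> \<zero> \<Longrightarrow> p \<in> A"
    using assms cochain_support by metis
  then show ?thesis
    using assms by (intro cochainI[of _ _ A]) (auto simp: cochain_closed cochain_off_simplex, metis r_null)
qed

section \<open>The cup product of cochains\<close>

lemma cup_product_simplex:
  "singular_simplex n X \<sigma> \<Longrightarrow> cup_product K X c d n \<sigma> =
    (\<Oplus>p\<in>{..n}. c p (front_face p \<sigma>) \<otimes> d (n - p) (back_face p (n - p) \<sigma>))"
  by (simp add: cup_product_def)

lemma cup_product_cochain:
  assumes "c \<in> cochains K X" "d \<in> cochains K X"
  shows "cup_product K X c d \<in> cochains K X"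
proof -
  obtain A B where A: "finite A" "\<And>p \<sigma>. c p \<sigma> \<noteq> \<zero> \<Longrightarrow> p \<in> A"
    and B: "finite B" "\<And>p \<sigma>. d p \<sigma> \<noteq> \<zero> \<Longrightarrow> p \<in> B"
    using assms cochain_support by metis
  show ?thesis
  \<comment> \<open>The finite set is the sumset of the two supports: a nonzero term needs both
    factors nonzero in complementary degrees.\<close>
  proof (rule cochainI[of _ _ "(\<lambda>(p, q). p + q) ` (A \<times> B)"])
    fix n \<sigma>
    assume nz: "cup_product K X c d n \<sigma> \<noteq> \<zero>"
    then have \<sigma>: "singular_simplex n X \<sigma>"
      by (auto simp: cup_product_def split: if_splits)
    have "\<exists>p\<in>{..n}. c p (front_face p \<sigma>) \<otimes> d (n - p) (back_face p (n - p) \<sigma>) \<noteq> \<zero>"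
      using nz unfolding cup_product_simplex[OF \<sigma>] by (rule finsum_nonzeroE) blast
    then obtain p where "p \<le> n" "c p (front_face p \<sigma>) \<noteq> \<zero>" "d (n - p) (back_face p (n - p) \<sigma>) \<noteq> \<zero>"
      using assms[THEN cochain_closed] by (metis atMost_iff l_null r_null)
    then show "n \<in> (\<lambda>(p, q). p + q) ` (A \<times> B)"
      using A(2) B(2) by (intro image_eqI[of _ _ "(p, n - p)"]) auto
  qed (use assms A B in \<open>auto simp: cup_product_def cochain_closed\<close>)
qed

text \<open>Either bracketing sums over all ways of cutting the simplex into three consecutive
  faces, one for each factor, so no passage to cohomology is required.\<close>

lemma cup_product_assoc:
  assumes "c \<in> cochains K X" "d \<in> cochains K X" "e \<in> cochains K X"
  shows "cup_product K X (cup_product K X c d) e = cup_product K X c (cup_product K X d e)"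
proof (intro ext)
  fix n \<sigma>
  note closed = assms[THEN cochain_closed]
  show "cup_product K X (cup_product K X c d) e n \<sigma> = cup_product K X c (cup_product K X d e) n \<sigma>"
  proof (cases "singular_simplex n X \<sigma>")
    case True
    \<comment> \<open>The middle face is written here as a back face of a front face, the form given
      by the left bracketing; the right bracketing yields it as a front face of a back face.\<close>
    define f where "f p q = c p (front_face p \<sigma>) \<otimes>
      (d q (back_face p q (front_face (p + q) \<sigma>)) \<otimes> e (n - (p + q)) (back_face (p + q) (n - (p + q)) \<sigma>))"
      for p q
    have f: "f p q \<in> carrier K" for p q
      by (simp add: f_def closed)
    have "cup_product K X (cup_product K X c d) e n \<sigma> = (\<Oplus>m\<in>{..n}. \<Oplus>p\<in>{..m}. f p (m - p))"
      unfolding cup_product_simplex[OF True]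
    proof (rule finsum_cong'[OF refl])
      fix m assume m: "m \<in> {..n}"
      then have "singular_simplex m X (front_face m \<sigma>)"
        using True by (simp add: singular_simplex_front_face)
      then have "cup_product K X c d m (front_face m \<sigma>) \<otimes> e (n - m) (back_face m (n - m) \<sigma>)
        = (\<Oplus>p\<in>{..m}. c p (front_face p (front_face m \<sigma>)) \<otimes> d (m - p) (back_face p (m - p) (front_face m \<sigma>))
            \<otimes> e (n - m) (back_face m (n - m) \<sigma>))"
        by (simp add: cup_product_simplex finsum_ldistr closed)
      also have "\<dots> = (\<Oplus>p\<in>{..m}. f p (m - p))"
        by (rule finsum_cong') (auto simp: f f_def front_face_front_face m_assoc closed)
      finally show "cup_product K X c d m (front_face m \<sigma>) \<otimes> e (n - m) (back_face m (n - m) \<sigma>) =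
        (\<Oplus>p\<in>{..m}. f p (m - p))" .
    qed (simp add: f)
    also have "\<dots> = (\<Oplus>p\<in>{..n}. \<Oplus>q\<in>{..n - p}. f p q)"
      by (rule finsum_triangle[OF f])
    also have "\<dots> = cup_product K X c (cup_product K X d e) n \<sigma>"
      unfolding cup_product_simplex[OF True]
    proof (rule finsum_cong'[OF refl])
      fix p assume p: "p \<in> {..n}"
      then have "singular_simplex (n - p) X (back_face p (n - p) \<sigma>)"
        using True by (simp add: singular_simplex_back_face)
      then have "c p (front_face p \<sigma>) \<otimes> cup_product K X d e (n - p) (back_face p (n - p) \<sigma>) =
        (\<Oplus>q\<in>{..n - p}. c p (front_face p \<sigma>) \<otimes> (d q (front_face q (back_face p (n - p) \<sigma>)) \<otimes>
          e (n - p - q) (back_face q (n - p - q) (back_face p (n - p) \<sigma>))))"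
        by (simp add: cup_product_simplex finsum_rdistr closed)
      also have "\<dots> = (\<Oplus>q\<in>{..n - p}. f p q)"
      proof (rule finsum_cong'[OF refl])
        fix q assume q: "q \<in> {..n - p}"
        show "c p (front_face p \<sigma>) \<otimes> (d q (front_face q (back_face p (n - p) \<sigma>)) \<otimes>
          e (n - p - q) (back_face q (n - p - q) (back_face p (n - p) \<sigma>))) = f p q"
          using p q back_face_front_face[of p q \<sigma> "n - p - q"] back_face_back_face[of q "n - p - q" p \<sigma>]
          by (simp add: f_def)
      qed (simp add: f)
      finally show "(\<Oplus>q\<in>{..n - p}. f p q) =
        c p (front_face p \<sigma>) \<otimes> cup_product K X d e (n - p) (back_face p (n - p) \<sigma>)" by simp
    qed (use cup_product_cochain[OF assms(2,3), THEN cochain_closed] in \<open>simp add: closed\<close>)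
    finally show ?thesis .
  qed (simp add: cup_product_def)
qed

lemma cup_product_add_left:
  assumes "c \<in> cochains K X" "d \<in> cochains K X" "e \<in> cochains K X"
  shows "cup_product K X (\<lambda>p \<sigma>. c p \<sigma> \<oplus> d p \<sigma>) e =
    (\<lambda>p \<sigma>. cup_product K X c e p \<sigma> \<oplus> cup_product K X d e p \<sigma>)"
  using assms[THEN cochain_closed] by (auto simp: fun_eq_iff cup_product_def l_distr finsum_addf Pi_def)

lemma cup_product_add_right:
  assumes "c \<in> cochains K X" "d \<in> cochains K X" "e \<in> cochains K X"
  shows "cup_product K X e (\<lambda>p \<sigma>. c p \<sigma> \<oplus> d p \<sigma>) =
    (\<lambda>p \<sigma>. cup_product K X e c p \<sigma> \<oplus> cup_product K X e d p \<sigma>)"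
  using assms[THEN cochain_closed] by (auto simp: fun_eq_iff cup_product_def r_distr finsum_addf Pi_def)

lemma cup_product_scale_left:
  assumes "c \<in> cochains K X" "d \<in> cochains K X" "r \<in> carrier K"
  shows "cup_product K X (\<lambda>p \<sigma>. r \<otimes> c p \<sigma>) d = (\<lambda>p \<sigma>. r \<otimes> cup_product K X c d p \<sigma>)"
  using assms(1,2)[THEN cochain_closed] assms(3)
  by (auto simp: fun_eq_iff cup_product_def finsum_rdistr m_assoc Pi_def)

lemma cup_product_scale_right:
  assumes "c \<in> cochains K X" "d \<in> cochains K X" "r \<in> carrier K"
  shows "cup_product K X c (\<lambda>p \<sigma>. r \<otimes> d p \<sigma>) = (\<lambda>p \<sigma>. r \<otimes> cup_product K X c d p \<sigma>)"
  using assms(1,2)[THEN cochain_closed] assms(3)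
  by (auto simp: fun_eq_iff cup_product_def finsum_rdistr m_lcomm Pi_def)

text \<open>The unit lives in degree 0, so only the cut at \<open>p = 0\<close> survives, and its
  back face is the whole simplex. On the right it is the cut at \<open>p = n\<close>.\<close>

lemma cup_product_unit_left:
  assumes "c \<in> cochains K X"
  shows "cup_product K X (\<lambda>p \<sigma>. if p = 0 \<and> singular_simplex 0 X \<sigma> then \<one> else \<zero>) c = c"
proof (intro ext)
  fix n \<sigma>
  note closed = assms[THEN cochain_closed]
  let ?u = "\<lambda>p \<sigma>. if p = 0 \<and> singular_simplex 0 X \<sigma> then \<one> else \<zero>"
  show "cup_product K X ?u c n \<sigma> = c n \<sigma>"
  proof (cases "singular_simplex n X \<sigma>")
    case True
    have "cup_product K X ?u c n \<sigma> = (\<Oplus>p\<in>{..n}. if 0 = p then c n \<sigma> else \<zero>)"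
      unfolding cup_product_simplex[OF True]
      using True by (intro finsum_cong') (auto simp: closed back_face_0 singular_simplex_front_face)
    also have "\<dots> = c n \<sigma>"
      by (subst finsum_singleton) (auto simp: closed)
    finally show ?thesis .
  qed (simp add: cup_product_def cochain_off_simplex[OF assms])
qed

lemma cup_product_unit_right:
  assumes "c \<in> cochains K X"
  shows "cup_product K X c (\<lambda>p \<sigma>. if p = 0 \<and> singular_simplex 0 X \<sigma> then \<one> else \<zero>) = c"
proof (intro ext)
  fix n \<sigma>
  note closed = assms[THEN cochain_closed]
  let ?u = "\<lambda>p \<sigma>. if p = 0 \<and> singular_simplex 0 X \<sigma> then \<one> else \<zero>"
  show "cup_product K X c ?u n \<sigma> = c n \<sigma>"
  proof (cases "singular_simplex n X \<sigma>")
    case True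
    have "cup_product K X c ?u n \<sigma> = (\<Oplus>p\<in>{..n}. if n = p then c n \<sigma> else \<zero>)"
      unfolding cup_product_simplex[OF True]
      using True singular_simplex_back_face[of n 0 X \<sigma>]
      by (intro finsum_cong') (auto simp: closed front_face_self)
    also have "\<dots> = c n \<sigma>"
      by (subst finsum_singleton) (auto simp: closed)
    finally show ?thesis .
  qed (simp add: cup_product_def cochain_off_simplex[OF assms])
qed

lemma cochain_ring_simps:
  "carrier (cochain_ring K X) = cochains K X"
  "c \<otimes>\<^bsub>cochain_ring K X\<^esub> d = cup_product K X c d"
  "\<one>\<^bsub>cochain_ring K X\<^esub> = (\<lambda>p \<sigma>. if p = 0 \<and> singular_simplex 0 X \<sigma> then \<one> else \<zero>)"
  "\<zero>\<^bsub>cochain_ring K X\<^esub> = (\<lambda>p \<sigma>. \<zero>)"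
  "c \<oplus>\<^bsub>cochain_ring K X\<^esub> d = (\<lambda>p \<sigma>. c p \<sigma> \<oplus> d p \<sigma>)"
  by (simp_all add: cochain_ring_def)

text \<open>Negation is presented as multiplication by minus one, so that closure of cochains,
  cocycles and coboundaries under negation is a case of closure under scalars.\<close>

lemma cochain_neg:
  assumes "c \<in> cochains K X"
  shows "(\<lambda>p \<sigma>. \<ominus> \<one> \<otimes> c p \<sigma>) \<in> cochains K X" "\<ominus> \<one> \<otimes> c p \<sigma> \<oplus> c p \<sigma> = \<zero>"
  using assms scale_cochain[of c X "\<lambda>_. \<ominus> \<one>"] cochain_closed[OF assms]
  by (simp_all add: l_minus l_neg)

lemma cochain_ring: "ring (cochain_ring K X)"
proof (rule ringI)
  show "abelian_group (cochain_ring K X)"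
  proof (rule abelian_groupI)
    fix c assume c: "c \<in> carrier (cochain_ring K X)"
    show "\<exists>d\<in>carrier (cochain_ring K X). d \<oplus>\<^bsub>cochain_ring K X\<^esub> c = \<zero>\<^bsub>cochain_ring K X\<^esub>"
      using c by (intro bexI[of _ "\<lambda>p \<sigma>. \<ominus> \<one> \<otimes> c p \<sigma>"]) (simp_all add: cochain_ring_simps cochain_neg)
  qed (auto simp: cochain_ring_simps add_cochain zero_cochain cochain_closed a_ac)
  show "Group.monoid (cochain_ring K X)"
    by (rule monoidI) (auto simp: cochain_ring_simps cup_product_cochain unit_cochain
        cup_product_assoc cup_product_unit_left cup_product_unit_right)
qed (simp_all add: cochain_ring_simps cup_product_add_left cup_product_add_right)

section \<open>The coboundary\<close>

lemma coboundary_0: "coboundary K X c 0 \<sigma> = \<zero>"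
  by (simp add: coboundary_def)

lemma coboundary_Suc:
  "singular_simplex (Suc n) X \<sigma> \<Longrightarrow>
    coboundary K X c (Suc n) \<sigma> = (\<Oplus>k\<in>{..Suc n}. sgn_pow k \<otimes> c n (singular_face (Suc n) k \<sigma>))"
  by (simp add: coboundary_def sgn_pow_def)

lemma coboundary_off_simplex: "\<not> singular_simplex n X \<sigma> \<Longrightarrow> coboundary K X c n \<sigma> = \<zero>"
  by (simp add: coboundary_def)

text \<open>Degree 0 and arguments that are not simplices carry default zeros; settling them here
  leaves only the sum over faces in later arguments.\<close>

lemma coboundary_eqI:
  assumes "\<And>\<sigma>. d 0 \<sigma> = \<zero>"
    and "\<And>n \<sigma>. \<not> singular_simplex n X \<sigma> \<Longrightarrow> d n \<sigma> = \<zero>"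
    and "\<And>n \<sigma>. singular_simplex (Suc n) X \<sigma> \<Longrightarrow>
      (\<Oplus>k\<in>{..Suc n}. sgn_pow k \<otimes> c n (singular_face (Suc n) k \<sigma>)) = d (Suc n) \<sigma>"
  shows "coboundary K X c = d"
proof (intro ext)
  fix n \<sigma>
  show "coboundary K X c n \<sigma> = d n \<sigma>"
    using assms by (cases n; cases "singular_simplex n X \<sigma>")
      (auto simp: coboundary_0 coboundary_off_simplex coboundary_Suc simp del: finsum_Suc)
qed

lemma coboundary_cochain:
  assumes "c \<in> cochains K X"
  shows "coboundary K X c \<in> cochains K X"
proof -
  obtain A where A: "finite A" "\<And>p \<sigma>. c p \<sigma> \<noteq> \<zero> \<Longrightarrow> p \<in> A"
    using assms cochain_support by metis
  show ?thesis
  proof (rule cochainI[of _ _ "Suc ` A"])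
    fix n \<sigma>
    assume nz: "coboundary K X c n \<sigma> \<noteq> \<zero>"
    then obtain m where m: "n = Suc m" "singular_simplex (Suc m) X \<sigma>"
      by (cases n) (auto simp: coboundary_def split: if_splits)
    have "\<exists>k\<in>{..Suc m}. sgn_pow k \<otimes> c m (singular_face (Suc m) k \<sigma>) \<noteq> \<zero>"
      using nz unfolding m coboundary_Suc[OF m(2)] by (rule finsum_nonzeroE) blast
    then obtain k where "c m (singular_face (Suc m) k \<sigma>) \<noteq> \<zero>"
      by (metis r_null sgn_pow_closed)
    then show "n \<in> Suc ` A"
      using A(2) m by blast
  qed (use assms A in \<open>auto simp: coboundary_def cochain_closed\<close>)
qed

lemma coboundary_zero: "coboundary K X (\<lambda>p \<sigma>. \<zero>) = (\<lambda>p \<sigma>. \<zero>)"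
  by (rule coboundary_eqI) (auto simp: finsum_zero simp del: finsum_Suc)

lemma coboundary_add:
  assumes "c \<in> cochains K X" "d \<in> cochains K X"
  shows "coboundary K X (\<lambda>p \<sigma>. c p \<sigma> \<oplus> d p \<sigma>) = (\<lambda>p \<sigma>. coboundary K X c p \<sigma> \<oplus> coboundary K X d p \<sigma>)"
  using assms[THEN cochain_closed]
  by (auto simp: fun_eq_iff coboundary_def r_distr finsum_addf Pi_def)

text \<open>The coboundary in degree \<open>Suc n\<close> reads the cochain in degree
  \<open>n\<close>, so the factor that comes out is \<open>r n\<close> and not
  \<open>r (Suc n)\<close>.\<close>

lemma coboundary_scale_Suc:
  assumes "c \<in> cochains K X" "\<And>p. r p \<in> carrier K"
  shows "coboundary K X (\<lambda>p \<sigma>. r p \<otimes> c p \<sigma>) (Suc n) \<sigma> = r n \<otimes> coboundary K X c (Suc n) \<sigma>"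
  using assms(1)[THEN cochain_closed] assms(2)
  by (auto simp: coboundary_def finsum_rdistr m_lcomm Pi_def simp flip: sgn_pow_def simp del: finsum_Suc)

lemma coboundary_scale:
  assumes "c \<in> cochains K X" "r \<in> carrier K"
  shows "coboundary K X (\<lambda>p \<sigma>. r \<otimes> c p \<sigma>) = (\<lambda>p \<sigma>. r \<otimes> coboundary K X c p \<sigma>)"
proof (intro ext)
  fix n \<sigma>
  show "coboundary K X (\<lambda>p \<sigma>. r \<otimes> c p \<sigma>) n \<sigma> = r \<otimes> coboundary K X c n \<sigma>"
    using assms coboundary_scale_Suc[OF assms(1), of "\<lambda>_. r"] by (cases n) (auto simp: coboundary_0)
qed

lemma coboundary_coboundary:
  assumes "c \<in> cochains K X"
  shows "coboundary K X (coboundary K X c) = (\<lambda>p \<sigma>. \<zero>)"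
proof (rule coboundary_eqI)
  fix n \<sigma>
  assume \<sigma>: "singular_simplex (Suc n) X \<sigma>"
  note closed = assms[THEN cochain_closed]
  show "(\<Oplus>k\<in>{..Suc n}. sgn_pow k \<otimes> coboundary K X c n (singular_face (Suc n) k \<sigma>)) = \<zero>"
  proof (cases n)
    case 0
    then show ?thesis by (simp add: coboundary_0 Pi_def)
  next
    case (Suc m)
    \<comment> \<open>The signed value on the \<open>i\<close>-th face of the \<open>k\<close>-th
      face.\<close>
    define f where "f k i = sgn_pow k \<otimes> (sgn_pow i \<otimes>
      c m (singular_face (Suc m) i (singular_face (Suc (Suc m)) k \<sigma>)))" for k i
    have f: "f k i \<in> carrier K" for k i
      by (simp add: f_def closed)
    have "(\<Oplus>k\<in>{..Suc n}. sgn_pow k \<otimes> coboundary K X c n (singular_face (Suc n) k \<sigma>)) =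
      (\<Oplus>k\<in>{..Suc n}. \<Oplus>i\<in>{..n}. f k i)"
    proof (rule finsum_cong'[OF refl])
      fix k assume "k \<in> {..Suc n}"
      then have "singular_simplex (Suc m) X (singular_face (Suc (Suc m)) k \<sigma>)"
        using \<sigma> Suc by (auto intro!: singular_simplex_singular_face_Suc)
      then show "sgn_pow k \<otimes> coboundary K X c n (singular_face (Suc n) k \<sigma>) = (\<Oplus>i\<in>{..n}. f k i)"
        unfolding Suc f_def by (simp add: coboundary_Suc finsum_rdistr closed Pi_def del: finsum_Suc)
    qed (simp add: f)
    also have "\<dots> = \<zero>"
    \<comment> \<open>By the simplicial identity the matched terms live on the same face, and
      \<open>sgn_pow (Suc j)\<close> against \<open>sgn_pow j\<close> gives them opposite
      signs.\<close>
    proof (rule finsum_simplicial_cancel[OF f])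
      fix i j assume "i \<le> j" "j \<le> n"
      then have "singular_face (Suc m) i (singular_face (Suc (Suc m)) (Suc j) \<sigma>) =
        singular_face (Suc m) j (singular_face (Suc (Suc m)) i \<sigma>)"
        using singular_face_singular_face Suc by blast
      then show "f i j \<oplus> f (Suc j) i = \<zero>"
        using closed by (simp add: f_def sgn_pow_Suc l_minus r_minus m_lcomm r_neg)
    qed
    finally show ?thesis .
  qed
qed auto

text \<open>The sign in the Leibniz rule, as an involution of cochains that preserves cocycles.\<close>

definition twist :: "('k, 'a) cochain \<Rightarrow> ('k, 'a) cochain" where
  "twist c = (\<lambda>p \<sigma>. sgn_pow p \<otimes> c p \<sigma>)"

lemma twist_cochain: "c \<in> cochains K X \<Longrightarrow> twist c \<in> cochains K X"
  unfolding twist_def by (rule scale_cochain) auto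

lemma twist_twist:
  assumes "c \<in> cochains K X"
  shows "twist (twist c) = c"
proof (intro ext)
  fix p \<sigma>
  have "twist (twist c) p \<sigma> = (sgn_pow p \<otimes> sgn_pow p) \<otimes> c p \<sigma>"
    using assms by (simp add: twist_def cochain_closed m_assoc)
  then show "twist (twist c) p \<sigma> = c p \<sigma>"
    using assms by (simp add: sgn_pow_square cochain_closed)
qed

text \<open>The graded Leibniz rule. Carrying the sign inside \<open>twist\<close> allows
  inhomogeneous \<open>c\<close>. For a fixed cut the two parts have n + 4 faces in total against n
  + 2 faces of the simplex, and the two surplus terms cancel.\<close>

lemma coboundary_cup_product:
  assumes "c \<in> cochains K X" "e \<in> cochains K X"
  shows "coboundary K X (cup_product K X c e) =
    (\<lambda>n \<sigma>. cup_product K X (coboundary K X c) e n \<sigma> \<oplus> cup_product K X (twist c) (coboundary K X e) n \<sigma>)"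
    (is "_ = ?R")
proof (rule coboundary_eqI)
  note closed = assms[THEN cochain_closed] assms[THEN coboundary_cochain, THEN cochain_closed]
    twist_cochain[OF assms(1), THEN cochain_closed]
  show "?R 0 \<sigma> = \<zero>" for \<sigma>
    using closed by (simp add: cup_product_def coboundary_0)
  show "?R n \<sigma> = \<zero>" if "\<not> singular_simplex n X \<sigma>" for n \<sigma>
    using that by (simp add: cup_product_def)
  fix n \<sigma>
  assume \<sigma>: "singular_simplex (Suc n) X \<sigma>"
  \<comment> \<open>\<open>H p k\<close> cuts the \<open>k\<close>-th face at \<open>p\<close>;
    \<open>F p k\<close> takes the \<open>k\<close>-th face of a front part of dimension
    \<open>Suc p\<close>; \<open>G p j\<close> takes the \<open>j\<close>-th face of a back part of
    dimension \<open>Suc (n - p)\<close>, with the sign of \<open>twist\<close>.\<close>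
  define H where "H p k = sgn_pow k \<otimes> (c p (front_face p (singular_face (Suc n) k \<sigma>)) \<otimes>
    e (n - p) (back_face p (n - p) (singular_face (Suc n) k \<sigma>)))" for p k
  define F where "F p k = sgn_pow k \<otimes> c p (singular_face (Suc p) k (front_face (Suc p) \<sigma>)) \<otimes>
    e (n - p) (back_face (Suc p) (n - p) \<sigma>)" for p k
  define G where "G p j = sgn_pow p \<otimes> c p (front_face p \<sigma>) \<otimes>
    (sgn_pow j \<otimes> e (n - p) (singular_face (Suc (n - p)) j (back_face p (Suc (n - p)) \<sigma>)))" for p j
  have HFG: "H p k \<in> carrier K" "F p k \<in> carrier K" "G p k \<in> carrier K" for p k
    by (simp_all add: H_def F_def G_def closed)
  \<comment> \<open>The last face of the front part cancels against the zeroth face of the back part.\<close>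
  have row: "(\<Oplus>k\<in>{..Suc n}. H p k) = (\<Oplus>k\<in>{..Suc p}. F p k) \<oplus> (\<Oplus>j\<in>{..Suc (n - p)}. G p j)"
    if "p \<le> n" for p
  proof -
    have n: "n = p + (n - p)" using that by simp
    have "F p (Suc p) \<oplus> G p 0 = \<zero>"
      using closed by (simp add: F_def G_def sgn_pow_Suc l_minus l_neg
          flip: front_face_eq_singular_face back_face_Suc)
    have "(\<Oplus>k\<in>{..Suc n}. H p k) = (\<Oplus>k\<in>{..p}. H p k) \<oplus> (\<Oplus>j\<in>{..n - p}. H p (p + Suc j))"
      using finsum_split_at[of "H p" p "n - p"] HFG(1) that by simp
    also have "(\<Oplus>k\<in>{..p}. H p k) = (\<Oplus>k\<in>{..p}. F p k)"
    proof (rule finsum_cong'[OF refl])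
      fix k assume "k \<in> {..p}"
      then show "H p k = F p k"
        using that front_face_singular_face_le[of k p n \<sigma>] back_face_singular_face_le[of k p "n - p" \<sigma>]
        by (simp add: H_def F_def m_assoc closed)
    qed (simp add: HFG)
    also have "(\<Oplus>j\<in>{..n - p}. H p (p + Suc j)) = (\<Oplus>j\<in>{..n - p}. G p (Suc j))"
    proof (rule finsum_cong'[OF refl])
      fix j assume "j \<in> {..n - p}"
      then have "front_face p (singular_face (Suc n) (p + Suc j) \<sigma>) = front_face p \<sigma>"
        "back_face p (n - p) (singular_face (Suc n) (p + Suc j) \<sigma>) =
          singular_face (Suc (n - p)) (Suc j) (back_face p (Suc (n - p)) \<sigma>)"
        using that front_face_singular_face_gt[of p "p + Suc j" n \<sigma>]
          back_face_singular_face_ge[of "Suc j" "n - p" p \<sigma>]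
        by auto
      then show "H p (p + Suc j) = G p (Suc j)"
        by (simp add: H_def G_def closed m_ac sgn_pow_add del: add_Suc_right)
    qed (simp add: HFG)
    \<comment> \<open>The vanishing pair is inserted to complete both index ranges, the last index
      for \<open>F\<close> and the index 0 for \<open>G\<close>.\<close>
    also have "(\<Oplus>k\<in>{..p}. F p k) \<oplus> (\<Oplus>j\<in>{..n - p}. G p (Suc j)) =
      ((\<Oplus>k\<in>{..p}. F p k) \<oplus> (\<Oplus>j\<in>{..n - p}. G p (Suc j))) \<oplus> (F p (Suc p) \<oplus> G p 0)"
      using HFG \<open>F p (Suc p) \<oplus> G p 0 = \<zero>\<close> by simp
    also have "\<dots> = (F p (Suc p) \<oplus> (\<Oplus>k\<in>{..p}. F p k)) \<oplus> ((\<Oplus>j\<in>{..n - p}. G p (Suc j)) \<oplus> G p 0)"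
      using HFG by (simp add: a_ac)
    also have "F p (Suc p) \<oplus> (\<Oplus>k\<in>{..p}. F p k) = (\<Oplus>k\<in>{..Suc p}. F p k)"
      using HFG by (subst finsum_Suc) auto
    also have "(\<Oplus>j\<in>{..n - p}. G p (Suc j)) \<oplus> G p 0 = (\<Oplus>j\<in>{..Suc (n - p)}. G p j)"
      using HFG by (subst finsum_Suc2) auto
    finally show ?thesis .
  qed
  have "(\<Oplus>k\<in>{..Suc n}. sgn_pow k \<otimes> cup_product K X c e n (singular_face (Suc n) k \<sigma>)) =
    (\<Oplus>k\<in>{..Suc n}. \<Oplus>p\<in>{..n}. H p k)"
  proof (rule finsum_cong'[OF refl])
    fix k assume "k \<in> {..Suc n}"
    then have "singular_simplex n X (singular_face (Suc n) k \<sigma>)"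
      using \<sigma> by (simp add: singular_simplex_singular_face_Suc)
    then show "sgn_pow k \<otimes> cup_product K X c e n (singular_face (Suc n) k \<sigma>) = (\<Oplus>p\<in>{..n}. H p k)"
      by (simp add: H_def cup_product_simplex finsum_rdistr closed)
  qed (simp add: HFG)
  also have "\<dots> = (\<Oplus>p\<in>{..n}. \<Oplus>k\<in>{..Suc n}. H p k)"
    by (rule finsum_swap) (auto simp: HFG)
  also have "\<dots> = (\<Oplus>p\<in>{..n}. (\<Oplus>k\<in>{..Suc p}. F p k) \<oplus> (\<Oplus>j\<in>{..Suc (n - p)}. G p j))"
    using HFG row by (intro finsum_cong') (auto simp del: finsum_Suc)
  also have "\<dots> = (\<Oplus>p\<in>{..n}. \<Oplus>k\<in>{..Suc p}. F p k) \<oplus> (\<Oplus>p\<in>{..n}. \<Oplus>j\<in>{..Suc (n - p)}. G p j)"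
    using HFG by (simp add: finsum_addf Pi_def del: finsum_Suc)
  also have "(\<Oplus>p\<in>{..n}. \<Oplus>k\<in>{..Suc p}. F p k) = cup_product K X (coboundary K X c) e (Suc n) \<sigma>"
  proof -
    have "cup_product K X (coboundary K X c) e (Suc n) \<sigma> = (\<Oplus>p\<in>{..n}.
      coboundary K X c (Suc p) (front_face (Suc p) \<sigma>) \<otimes> e (n - p) (back_face (Suc p) (n - p) \<sigma>))"
      \<comment> \<open>The cut at 0 drops out because a coboundary vanishes in degree 0; the
        remaining cuts are reindexed by one.\<close>
      unfolding cup_product_simplex[OF \<sigma>] using closed
      by (subst finsum_Suc2) (auto simp: coboundary_0)
    also have "\<dots> = (\<Oplus>p\<in>{..n}. \<Oplus>k\<in>{..Suc p}. F p k)"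
    proof (rule finsum_cong'[OF refl])
      fix p assume "p \<in> {..n}"
      then have "singular_simplex (Suc p) X (front_face (Suc p) \<sigma>)"
        using \<sigma> by (simp add: singular_simplex_front_face)
      then show "coboundary K X c (Suc p) (front_face (Suc p) \<sigma>) \<otimes> e (n - p) (back_face (Suc p) (n - p) \<sigma>) =
          (\<Oplus>k\<in>{..Suc p}. F p k)"
        unfolding F_def by (simp add: coboundary_Suc finsum_ldistr closed Pi_def del: finsum_Suc)
    qed (simp add: HFG)
    finally show ?thesis by simp
  qed
  also have "(\<Oplus>p\<in>{..n}. \<Oplus>j\<in>{..Suc (n - p)}. G p j) = cup_product K X (twist c) (coboundary K X e) (Suc n) \<sigma>"
  proof -
    have "cup_product K X (twist c) (coboundary K X e) (Suc n) \<sigma> = (\<Oplus>p\<in>{..n}.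
      twist c p (front_face p \<sigma>) \<otimes> coboundary K X e (Suc n - p) (back_face p (Suc n - p) \<sigma>))"
      \<comment> \<open>Here the cut at \<open>Suc n\<close> drops out, since it evaluates the
        coboundary of \<open>e\<close> in degree 0.\<close>
      unfolding cup_product_simplex[OF \<sigma>] using closed
      by (subst finsum_Suc) (auto simp: coboundary_0)
    also have "\<dots> = (\<Oplus>p\<in>{..n}. \<Oplus>j\<in>{..Suc (n - p)}. G p j)"
    proof (rule finsum_cong'[OF refl])
      fix p assume p: "p \<in> {..n}"
      then have "singular_simplex (Suc (n - p)) X (back_face p (Suc (n - p)) \<sigma>)"
        using \<sigma> by (intro singular_simplex_back_face) auto
      then have "twist c p (front_face p \<sigma>) \<otimes> coboundary K X e (Suc (n - p)) (back_face p (Suc (n - p)) \<sigma>)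
        = (\<Oplus>j\<in>{..Suc (n - p)}. G p j)"
        unfolding G_def twist_def
        by (simp add: coboundary_Suc finsum_rdistr closed Pi_def del: finsum_Suc)
      then show "twist c p (front_face p \<sigma>) \<otimes> coboundary K X e (Suc n - p) (back_face p (Suc n - p) \<sigma>)
        = (\<Oplus>j\<in>{..Suc (n - p)}. G p j)"
        using p by (simp add: Suc_diff_le)
    qed (simp add: HFG)
    finally show ?thesis by simp
  qed
  finally show "(\<Oplus>k\<in>{..Suc n}. sgn_pow k \<otimes> cup_product K X c e n (singular_face (Suc n) k \<sigma>)) = ?R (Suc n) \<sigma>" .
qed

end

section \<open>The cohomology ring\<close>

text \<open>The ring axioms read only fields that \<open>ring.extend\<close> copies. This carries
  them from the quotient ring to the module record \<open>cohomology\<close>.\<close>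

lemma ring_extend_ring:
  assumes "ring R"
  shows "ring (ring.extend R m)"
proof -
  interpret ring R by (rule assms)
  have simps: "carrier (ring.extend R m) = carrier R" "add (ring.extend R m) = add R"
    "monoid.mult (ring.extend R m) = monoid.mult R" "zero (ring.extend R m) = zero R"
    "one (ring.extend R m) = one R"
    by (simp_all add: ring.defs)
  show ?thesis
  proof (rule ringI)
    show "abelian_group (ring.extend R m)"
      by (rule abelian_groupI) (auto simp: simps a_ac intro: a_inv_closed l_neg bexI[of _ "\<ominus>\<^bsub>R\<^esub> _"])
    show "Group.monoid (ring.extend R m)"
      by (rule monoidI) (auto simp: simps m_assoc)
  qed (auto simp: simps l_distr r_distr)
qed

context cochain_algebra
begin

section \<open>The ring of cocycles and its ideal of coboundaries\<close>

lemma cocycle_cochain: "z \<in> cocycles K X \<Longrightarrow> z \<in> cochains K X"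
  by (simp add: cocycles_def)

lemma cocycle_closed: "z \<in> cocycles K X \<Longrightarrow> z p \<sigma> \<in> carrier K"
  using cocycle_cochain cochain_closed by blast

lemma coboundary_cocycle: "z \<in> cocycles K X \<Longrightarrow> coboundary K X z = (\<lambda>p \<sigma>. \<zero>)"
  by (simp add: cocycles_def)

lemma coboundary_in_coboundaries: "c \<in> cochains K X \<Longrightarrow> coboundary K X c \<in> coboundaries K X"
  by (simp add: coboundaries_def)

lemma zero_cocycle: "(\<lambda>p \<sigma>. \<zero>) \<in> cocycles K X"
  by (simp add: cocycles_def zero_cochain coboundary_zero)

lemma add_cocycle:
  "z \<in> cocycles K X \<Longrightarrow> w \<in> cocycles K X \<Longrightarrow> (\<lambda>p \<sigma>. z p \<sigma> \<oplus> w p \<sigma>) \<in> cocycles K X"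
  by (simp add: cocycles_def add_cochain coboundary_add)

lemma scale_cocycle:
  "z \<in> cocycles K X \<Longrightarrow> r \<in> carrier K \<Longrightarrow> (\<lambda>p \<sigma>. r \<otimes> z p \<sigma>) \<in> cocycles K X"
  by (simp add: cocycles_def scale_cochain coboundary_scale)

lemma twist_cocycle:
  assumes "z \<in> cocycles K X"
  shows "twist z \<in> cocycles K X"
proof -
  have "coboundary K X (twist z) n \<sigma> = \<zero>" for n \<sigma>
    using coboundary_scale_Suc[OF cocycle_cochain[OF assms], of sgn_pow] coboundary_cocycle[OF assms]
    by (cases n) (auto simp: twist_def coboundary_0)
  then show ?thesis
    using assms by (auto simp: cocycles_def twist_cochain)
qed

lemma cup_product_zero_left: "c \<in> cochains K X \<Longrightarrow> cup_product K X (\<lambda>p \<sigma>. \<zero>) c = (\<lambda>p \<sigma>. \<zero>)"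
  by (auto simp: cup_product_def cochain_closed finsum_zero fun_eq_iff)

lemma cup_product_zero_right: "c \<in> cochains K X \<Longrightarrow> cup_product K X c (\<lambda>p \<sigma>. \<zero>) = (\<lambda>p \<sigma>. \<zero>)"
  by (auto simp: cup_product_def cochain_closed finsum_zero fun_eq_iff)

lemma cup_product_cocycle:
  "z \<in> cocycles K X \<Longrightarrow> w \<in> cocycles K X \<Longrightarrow> cup_product K X z w \<in> cocycles K X"
  by (simp add: cocycles_def cup_product_cochain coboundary_cup_product cup_product_zero_left
      cup_product_zero_right twist_cochain)

text \<open>On a 1-simplex the two endpoints contribute one with opposite signs; in higher degrees
  the unit vanishes.\<close>

lemma unit_cocycle: "\<one>\<^bsub>cochain_ring K X\<^esub> \<in> cocycles K X"
proof -
  have "coboundary K X (\<lambda>p \<sigma>. if p = 0 \<and> singular_simplex 0 X \<sigma> then \<one> else \<zero>) = (\<lambda>p \<sigma>. \<zero>)"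
  proof (rule coboundary_eqI)
    fix n \<sigma>
    assume \<sigma>: "singular_simplex (Suc n) X \<sigma>"
    show "(\<Oplus>k\<in>{..Suc n}. sgn_pow k \<otimes> (if n = 0 \<and> singular_simplex 0 X (singular_face (Suc n) k \<sigma>)
      then \<one> else \<zero>)) = \<zero>"
    proof (cases n)
      case 0
      then have "singular_simplex 0 X (singular_face (Suc 0) 0 \<sigma>)"
        "singular_simplex 0 X (singular_face (Suc 0) (Suc 0) \<sigma>)"
        using \<sigma> singular_simplex_singular_face_Suc by blast+
      then show ?thesis using 0 by (simp add: Pi_def sgn_pow_Suc l_neg)
    qed (simp add: finsum_zero del: finsum_Suc)
  qed auto
  then show ?thesis
    by (simp add: cocycles_def cochain_ring_simps unit_cochain)
qed

lemma cochain_ring_uminus: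
  assumes "c \<in> cochains K X"
  shows "\<ominus>\<^bsub>cochain_ring K X\<^esub> c = (\<lambda>p \<sigma>. \<ominus> \<one> \<otimes> c p \<sigma>)"
proof -
  interpret R: ring "cochain_ring K X" by (rule cochain_ring)
  show ?thesis
    using assms cochain_neg[OF assms]
    by (intro R.minus_equality) (simp_all add: cochain_ring_simps)
qed

lemma cocycles_subring: "subring (cocycles K X) (cochain_ring K X)"
proof -
  interpret R: ring "cochain_ring K X" by (rule cochain_ring)
  show ?thesis
    by (rule R.subringI)
      (auto simp: cocycle_cochain unit_cocycle scale_cocycle cup_product_cocycle add_cocycle
        cochain_ring_uminus cochain_ring_simps(1,2,5))
qed

lemma cocycle_ring: "ring (cocycle_ring K X)"
  unfolding cocycle_ring_def using ring.subring_is_ring[OF cochain_ring cocycles_subring] .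

lemma cocycle_ring_simps:
  "carrier (cocycle_ring K X) = cocycles K X"
  "c \<otimes>\<^bsub>cocycle_ring K X\<^esub> d = cup_product K X c d"
  "\<one>\<^bsub>cocycle_ring K X\<^esub> = \<one>\<^bsub>cochain_ring K X\<^esub>"
  "\<zero>\<^bsub>cocycle_ring K X\<^esub> = (\<lambda>p \<sigma>. \<zero>)"
  "c \<oplus>\<^bsub>cocycle_ring K X\<^esub> d = (\<lambda>p \<sigma>. c p \<sigma> \<oplus> d p \<sigma>)"
  by (simp_all add: cocycle_ring_def cochain_ring_simps)

lemma coboundaries_cocycles: "b \<in> coboundaries K X \<Longrightarrow> b \<in> cocycles K X"
  by (auto simp: coboundaries_def cocycles_def coboundary_cochain coboundary_coboundary)

lemma zero_coboundary: "(\<lambda>p \<sigma>. \<zero>) \<in> coboundaries K X"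
  unfolding coboundaries_def by (rule image_eqI[OF _ zero_cochain]) (simp add: coboundary_zero)

lemma add_coboundary:
  assumes "b \<in> coboundaries K X" "b' \<in> coboundaries K X"
  shows "(\<lambda>p \<sigma>. b p \<sigma> \<oplus> b' p \<sigma>) \<in> coboundaries K X"
  using assms unfolding coboundaries_def by (auto simp flip: coboundary_add simp: add_cochain)

lemma scale_coboundary:
  assumes "b \<in> coboundaries K X" "r \<in> carrier K"
  shows "(\<lambda>p \<sigma>. r \<otimes> b p \<sigma>) \<in> coboundaries K X"
  using assms unfolding coboundaries_def by (auto simp flip: coboundary_scale simp: scale_cochain)

lemma cup_product_coboundary_left:
  assumes "b \<in> coboundaries K X" "z \<in> cocycles K X"
  shows "cup_product K X b z \<in> coboundaries K X"
proof -
  obtain c where c: "c \<in> cochains K X" "b = coboundary K X c"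
    using assms by (auto simp: coboundaries_def)
  \<comment> \<open>In the Leibniz rule the second term contains the coboundary of \<open>z\<close>,
    which is zero.\<close>
  have "coboundary K X (cup_product K X c z) = cup_product K X b z"
    using assms c cup_product_cochain[OF coboundary_cochain[OF c(1)] cocycle_cochain[OF assms(2)],
        THEN cochain_closed]
    by (simp add: coboundary_cup_product cup_product_zero_right coboundary_cocycle
        cocycle_cochain twist_cochain cochain_closed cup_product_cochain coboundary_cochain)
  then show ?thesis
    using c assms by (metis coboundary_in_coboundaries cup_product_cochain cocycle_cochain)
qed

lemma cup_product_coboundary_right:
  assumes "b \<in> coboundaries K X" "z \<in> cocycles K X"
  shows "cup_product K X z b \<in> coboundaries K X"
proof -
  obtain c where c: "c \<in> cochains K X" "b = coboundary K X c"
    using assms by (auto simp: coboundaries_def)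
  \<comment> \<open>The primitive starts with \<open>twist z\<close> because the Leibniz rule twists
    it again, giving back \<open>z\<close>; the other term vanishes since \<open>twist z\<close> is
    a cocycle.\<close>
  have "coboundary K X (cup_product K X (twist z) c) = cup_product K X z b"
    using assms c cup_product_cochain[OF cocycle_cochain[OF assms(2)] coboundary_cochain[OF c(1)],
        THEN cochain_closed]
    by (simp add: coboundary_cup_product cup_product_zero_left
        twist_twist[OF cocycle_cochain[OF assms(2)]]
        coboundary_cocycle twist_cocycle cocycle_cochain twist_cochain cochain_closed
        cup_product_cochain coboundary_cochain)
  then show ?thesis
    using c assms by (metis coboundary_in_coboundaries cup_product_cochain twist_cocycle cocycle_cochain)
qed

lemma coboundaries_ideal: "ideal (coboundaries K X) (cocycle_ring K X)"
proof -
  interpret R: ring "cocycle_ring K X" by (rule cocycle_ring)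
  show ?thesis
  proof (rule idealI[OF cocycle_ring])
    show "subgroup (coboundaries K X) (add_monoid (cocycle_ring K X))"
    proof (rule R.add.subgroupI)
      fix b assume b: "b \<in> coboundaries K X"
      then have "b \<in> cocycles K X" by (rule coboundaries_cocycles)
      then have "\<ominus>\<^bsub>cocycle_ring K X\<^esub> b = (\<lambda>p \<sigma>. \<ominus> \<one> \<otimes> b p \<sigma>)"
        using cochain_neg[OF cocycle_cochain[of b X]] scale_cocycle[of b X "\<ominus> \<one>"]
        by (intro R.minus_equality) (simp_all add: cocycle_ring_simps)
      then show "\<ominus>\<^bsub>cocycle_ring K X\<^esub> b \<in> coboundaries K X"
        using scale_coboundary[OF b, of "\<ominus> \<one>"] by simp
    qed (use coboundaries_cocycles zero_coboundary[of X] add_coboundary in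
        \<open>auto simp: cocycle_ring_simps simp del: empty_iff\<close>)
  qed (auto simp: cocycle_ring_simps cup_product_coboundary_left cup_product_coboundary_right)
qed

section \<open>Cohomology classes and their operations on representatives\<close>

definition cohomology_class :: "'a topology \<Rightarrow> ('k, 'a) cochain \<Rightarrow> ('k, 'a) cochain set" where
  "cohomology_class X z = coboundaries K X +>\<^bsub>cocycle_ring K X\<^esub> z"

lemma cohomology_class_eq: "cohomology_class X z = {\<lambda>p \<sigma>. b p \<sigma> \<oplus> z p \<sigma> |b. b \<in> coboundaries K X}"
  by (auto simp: cohomology_class_def a_r_coset_def' cocycle_ring_simps)

lemma cohomology_class_eq_iff:
  assumes "z \<in> cocycles K X" "w \<in> cocycles K X"
  shows "cohomology_class X z = cohomology_class X w \<longleftrightarrow> (\<exists>b\<in>coboundaries K X. z = (\<lambda>p \<sigma>. b p \<sigma> \<oplus> w p \<sigma>))"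
proof -
  interpret I: ideal "coboundaries K X" "cocycle_ring K X" by (rule coboundaries_ideal)
  have "cohomology_class X z = cohomology_class X w \<longleftrightarrow> z \<in> cohomology_class X w"
  proof
    show "z \<in> cohomology_class X w" if "cohomology_class X z = cohomology_class X w"
      using I.a_rcos_self[of z] assms that by (simp add: cohomology_class_def cocycle_ring_simps)
    show "cohomology_class X z = cohomology_class X w" if "z \<in> cohomology_class X w"
      using I.a_repr_independence[OF that[unfolded cohomology_class_def]] I.a_subgroup assms
      by (simp add: cohomology_class_def cocycle_ring_simps)
  qed
  then show ?thesis by (auto simp: cohomology_class_eq)
qed

text \<open>The image of a coset under \<open>\<phi>\<close> may be only part of a coset, and adding
  all coboundaries fills it up. Scalar multiplication and the maps induced on cohomology are both
  defined in this way.\<close>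

lemma set_add_image_cohomology_class:
  assumes "\<phi> z \<in> cocycles K X" "z \<in> cocycles K Y"
    and "\<And>b. b \<in> coboundaries K Y \<Longrightarrow> \<phi> b \<in> coboundaries K X"
    and "\<And>b. b \<in> coboundaries K Y \<Longrightarrow> \<phi> (\<lambda>p \<sigma>. b p \<sigma> \<oplus> z p \<sigma>) = (\<lambda>p \<sigma>. \<phi> b p \<sigma> \<oplus> \<phi> z p \<sigma>)"
  shows "coboundaries K X <+>\<^bsub>cocycle_ring K X\<^esub> \<phi> ` cohomology_class Y z = cohomology_class X (\<phi> z)" (is "?L = ?R")
proof
  have closed: "b p \<sigma> \<in> carrier K" if "b \<in> coboundaries K X" for b p \<sigma>
    using that coboundaries_cocycles cocycle_cochain cochain_closed by metis
  have \<phi>z: "\<phi> z p \<sigma> \<in> carrier K" for p \<sigma>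
    using assms(1) cocycle_cochain cochain_closed by metis
  show "?L \<subseteq> ?R"
  proof
    fix x assume "x \<in> ?L"
    then obtain b b' where b: "b \<in> coboundaries K X" "b' \<in> coboundaries K Y"
      and x: "x = (\<lambda>p \<sigma>. b p \<sigma> \<oplus> (\<phi> b' p \<sigma> \<oplus> \<phi> z p \<sigma>))"
      using assms(4) by (auto simp: set_add_def' cohomology_class_eq cocycle_ring_simps)
    have "x = (\<lambda>p \<sigma>. (b p \<sigma> \<oplus> \<phi> b' p \<sigma>) \<oplus> \<phi> z p \<sigma>)"
      using b assms(3) closed \<phi>z by (simp add: x a_assoc)
    then show "x \<in> ?R"
      using add_coboundary[OF b(1) assms(3)[OF b(2)]] by (auto simp: cohomology_class_eq)
  qed
  \<comment> \<open>For the reverse inclusion the representative \<open>z\<close> itself suffices,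
    the summand from \<open>coboundaries K X\<close> being free.\<close>
  have "z \<in> cohomology_class Y z"
    using assms(2) cocycle_closed[OF assms(2)] unfolding cohomology_class_eq
    by (auto intro!: exI[of _ "\<lambda>p \<sigma>. \<zero>"] simp: zero_coboundary fun_eq_iff)
  then show "?R \<subseteq> ?L"
    by (auto simp: cohomology_class_eq[of X] set_add_def' cocycle_ring_simps)
qed

lemma cohomology_ring: "ring (cohomology K X)"
  unfolding cohomology_def using ideal.quotient_is_ring[OF coboundaries_ideal]
  by (rule ring_extend_ring)

lemma carrier_cohomology: "carrier (cohomology K X) = cohomology_class X ` cocycles K X"
  by (auto simp: cohomology_def ring.defs FactRing_def A_RCOSETS_def' a_r_coset_def'
      cohomology_class_def cocycle_ring_simps)

lemma zero_cohomology: "\<zero>\<^bsub>cohomology K X\<^esub> = cohomology_class X (\<lambda>p \<sigma>. \<zero>)"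
proof -
  have "(\<lambda>p \<sigma>. b p \<sigma> \<oplus> \<zero>) = b" if "b \<in> coboundaries K X" for b
    using coboundaries_cocycles[OF that] by (simp add: cocycle_closed)
  then show ?thesis
    by (simp add: cohomology_def ring.defs FactRing_def cohomology_class_eq set_eq_iff)
      (metis (no_types, lifting))
qed

lemma one_cohomology: "\<one>\<^bsub>cohomology K X\<^esub> = cohomology_class X \<one>\<^bsub>cochain_ring K X\<^esub>"
  by (simp add: cohomology_def ring.defs FactRing_simps cohomology_class_def cocycle_ring_simps)

lemma add_cohomology:
  assumes "z \<in> cocycles K X" "w \<in> cocycles K X"
  shows "cohomology_class X z \<oplus>\<^bsub>cohomology K X\<^esub> cohomology_class X w = cohomology_class X (\<lambda>p \<sigma>. z p \<sigma> \<oplus> w p \<sigma>)"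
proof -
  interpret I: ideal "coboundaries K X" "cocycle_ring K X" by (rule coboundaries_ideal)
  show ?thesis
    using I.a_rcos_sum[of z w] assms
    by (simp add: cohomology_def ring.defs FactRing_simps cohomology_class_def cocycle_ring_simps)
qed

lemma mult_cohomology:
  assumes "z \<in> cocycles K X" "w \<in> cocycles K X"
  shows "cohomology_class X z \<otimes>\<^bsub>cohomology K X\<^esub> cohomology_class X w = cohomology_class X (cup_product K X z w)"
proof -
  interpret I: ideal "coboundaries K X" "cocycle_ring K X" by (rule coboundaries_ideal)
  show ?thesis
    using I.rcoset_mult_add[of z w] assms
    by (simp add: cohomology_def ring.defs FactRing_simps cohomology_class_def cocycle_ring_simps)
qed

lemma smult_cohomology:
  assumes "z \<in> cocycles K X" "r \<in> carrier K"
  shows "r \<odot>\<^bsub>cohomology K X\<^esub> cohomology_class X z = cohomology_class X (\<lambda>p \<sigma>. r \<otimes> z p \<sigma>)"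
proof -
  have "r \<odot>\<^bsub>cohomology K X\<^esub> cohomology_class X z =
    coboundaries K X <+>\<^bsub>cocycle_ring K X\<^esub> (\<lambda>z p \<sigma>. r \<otimes> z p \<sigma>) ` cohomology_class X z"
    by (simp add: cohomology_def ring.defs module.defs)
  also have "\<dots> = cohomology_class X (\<lambda>p \<sigma>. r \<otimes> z p \<sigma>)"
  proof (rule set_add_image_cohomology_class)
    fix b assume "b \<in> coboundaries K X"
    then have "b \<in> cocycles K X"
      by (rule coboundaries_cocycles)
    then show "(\<lambda>p \<sigma>. r \<otimes> (b p \<sigma> \<oplus> z p \<sigma>)) = (\<lambda>p \<sigma>. r \<otimes> b p \<sigma> \<oplus> r \<otimes> z p \<sigma>)"
      using assms by (simp add: r_distr cocycle_closed)
  qed (use assms scale_cocycle scale_coboundary in auto)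
  finally show ?thesis .
qed

lemma cohomology_module: "module K (cohomology K X)"
proof -
  interpret H: ring "cohomology K X" by (rule cohomology_ring)
  show ?thesis
    by (rule moduleI)
      (auto simp: is_cring H.is_abelian_group carrier_cohomology smult_cohomology add_cohomology
        scale_cocycle add_cocycle cocycle_closed l_distr r_distr m_assoc)
qed

text \<open>Makes multiplication by fixed classes on either side linear, as needed to expand a
  product factor by factor.\<close>

lemma smult_mult_cohomology:
  assumes "r \<in> carrier K" "x \<in> carrier (cohomology K X)" "y \<in> carrier (cohomology K X)"
  shows "(r \<odot>\<^bsub>cohomology K X\<^esub> x) \<otimes>\<^bsub>cohomology K X\<^esub> y = r \<odot>\<^bsub>cohomology K X\<^esub> (x \<otimes>\<^bsub>cohomology K X\<^esub> y)"
    and "x \<otimes>\<^bsub>cohomology K X\<^esub> (r \<odot>\<^bsub>cohomology K X\<^esub> y) = r \<odot>\<^bsub>cohomology K X\<^esub> (x \<otimes>\<^bsub>cohomology K X\<^esub> y)"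
  using assms
  by (auto simp: carrier_cohomology smult_cohomology mult_cohomology scale_cocycle
      cup_product_cocycle cocycle_cochain cup_product_scale_left cup_product_scale_right)

section \<open>Degrees\<close>

text \<open>Zero is homogeneous of every degree, so each \<open>cohomology_deg\<close> contains the
  zero class.\<close>

definition homogeneous :: "nat \<Rightarrow> ('k, 'a) cochain \<Rightarrow> bool" where
  "homogeneous p c \<longleftrightarrow> (\<forall>q. q \<noteq> p \<longrightarrow> c q = (\<lambda>\<sigma>. \<zero>))"

lemma cohomology_deg_eq: "cohomology_deg K p X = cohomology_class X ` {z \<in> cocycles K X. homogeneous p z}"
  by (auto simp: cohomology_deg_def cohomology_class_def homogeneous_def)

lemma cohomology_deg_carrier: "x \<in> cohomology_deg K p X \<Longrightarrow> x \<in> carrier (cohomology K X)"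
  by (auto simp: cohomology_deg_eq carrier_cohomology)

lemma zero_in_cohomology_deg: "\<zero>\<^bsub>cohomology K X\<^esub> \<in> cohomology_deg K p X"
  using zero_cocycle by (auto simp: cohomology_deg_eq zero_cohomology homogeneous_def)

lemma one_in_cohomology_deg: "\<one>\<^bsub>cohomology K X\<^esub> \<in> cohomology_deg K 0 X"
proof -
  have "homogeneous 0 \<one>\<^bsub>cochain_ring K X\<^esub>"
    by (simp add: homogeneous_def cochain_ring_simps)
  then show ?thesis
    using unit_cocycle by (auto simp: cohomology_deg_eq one_cohomology)
qed

text \<open>In another total degree every cut gives one of the two factors a wrong degree.\<close>

lemma homogeneous_cup_product:
  assumes "c \<in> cochains K X" "d \<in> cochains K X" "homogeneous p c" "homogeneous q d"
  shows "homogeneous (p + q) (cup_product K X c d)"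
  unfolding homogeneous_def
proof (intro allI impI ext)
  fix n \<sigma> assume n: "n \<noteq> p + q"
  have "c k (front_face k \<sigma>) \<otimes> d (n - k) (back_face k (n - k) \<sigma>) = \<zero>" if "k \<le> n" for k
    using assms n that cochain_closed[OF assms(1)] cochain_closed[OF assms(2)]
    by (cases "k = p") (auto simp: homogeneous_def)
  then show "cup_product K X c d n \<sigma> = \<zero>"
    using add.finprod_one_eqI[of "{..n}"] by (auto simp: cup_product_def)
qed

lemma mult_in_cohomology_deg:
  assumes "x \<in> cohomology_deg K p X" "y \<in> cohomology_deg K q X"
  shows "x \<otimes>\<^bsub>cohomology K X\<^esub> y \<in> cohomology_deg K (p + q) X"
  using assms by (auto simp: cohomology_deg_eq mult_cohomology cup_product_cocycle
      homogeneous_cup_product cocycle_cochain)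

section \<open>Projection to a single degree\<close>

definition component :: "nat \<Rightarrow> ('k, 'a) cochain \<Rightarrow> ('k, 'a) cochain" where
  "component p c = (\<lambda>q \<sigma>. if q = p then c q \<sigma> else \<zero>)"

lemma component_cochain: "c \<in> cochains K X \<Longrightarrow> component p c \<in> cochains K X"
  by (rule cochainI[of _ _ "{p}"])
    (auto simp: component_def cochain_closed cochain_off_simplex split: if_splits)

lemma homogeneous_component: "homogeneous p (component p c)"
  by (simp add: homogeneous_def component_def)

lemma component_homogeneous: "homogeneous p c \<Longrightarrow> component p c = c"
  by (auto simp: homogeneous_def component_def fun_eq_iff)

lemma coboundary_component: "coboundary K X (component p c) = component (Suc p) (coboundary K X c)"
proof (intro ext)
  fix n \<sigma>
  show "coboundary K X (component p c) n \<sigma> = component (Suc p) (coboundary K X c) n \<sigma>"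
    by (cases n; cases "singular_simplex n X \<sigma>")
      (auto simp: coboundary_0 coboundary_off_simplex coboundary_Suc component_def finsum_zero
        simp del: finsum_Suc)
qed

lemma component_cocycle: "z \<in> cocycles K X \<Longrightarrow> component p z \<in> cocycles K X"
  by (auto simp: cocycles_def component_cochain coboundary_component) (simp add: component_def)

text \<open>The part of a coboundary in degree \<open>Suc q\<close> is the coboundary of the part of
  a primitive in degree \<open>q\<close>; in degree 0 coboundaries vanish.\<close>

lemma component_coboundary:
  assumes "b \<in> coboundaries K X"
  shows "component p b \<in> coboundaries K X"
proof -
  obtain c where c: "c \<in> cochains K X" "b = coboundary K X c"
    using assms by (auto simp: coboundaries_def)
  show ?thesis
  proof (cases p)
    case 0
    then have "component p b = (\<lambda>p \<sigma>. \<zero>)"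
      by (auto simp: c component_def coboundary_0 fun_eq_iff)
    then show ?thesis using zero_coboundary by simp
  next
    case (Suc q)
    then show ?thesis
      using coboundary_in_coboundaries[OF component_cochain[OF c(1), of q]]
      by (simp add: coboundary_component c)
  qed
qed

section \<open>Functoriality\<close>

context
  fixes X :: "'a topology" and Y :: "'b topology" and g :: "'a \<Rightarrow> 'b"
  assumes g: "continuous_map X Y g"
begin

lemma singular_simplex_map: "singular_simplex p X \<sigma> \<Longrightarrow> singular_simplex p Y (simplex_map p g \<sigma>)"
  using singular_simplex_simplex_map g by blast

lemma cochain_map_cochain:
  assumes "c \<in> cochains K Y"
  shows "cochain_map K X g c \<in> cochains K X"
proof -
  obtain A where "finite A" "\<And>p \<sigma>. c p \<sigma> \<noteq> \<zero> \<Longrightarrow> p \<in> A"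
    using assms cochain_support by metis
  then show ?thesis
    by (intro cochainI[of _ _ A]) (auto simp: cochain_map_def cochain_closed[OF assms] split: if_splits)
qed

lemma cochain_map_add:
  "c \<in> cochains K Y \<Longrightarrow> d \<in> cochains K Y \<Longrightarrow> cochain_map K X g (\<lambda>p \<sigma>. c p \<sigma> \<oplus> d p \<sigma>) =
    (\<lambda>p \<sigma>. cochain_map K X g c p \<sigma> \<oplus> cochain_map K X g d p \<sigma>)"
  by (auto simp: cochain_map_def fun_eq_iff)

lemma cochain_map_scale:
  "r \<in> carrier K \<Longrightarrow> cochain_map K X g (\<lambda>p \<sigma>. r \<otimes> c p \<sigma>) = (\<lambda>p \<sigma>. r \<otimes> cochain_map K X g c p \<sigma>)"
  by (auto simp: cochain_map_def fun_eq_iff)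

lemma cochain_map_unit: "cochain_map K X g \<one>\<^bsub>cochain_ring K Y\<^esub> = \<one>\<^bsub>cochain_ring K X\<^esub>"
  using singular_simplex_map by (auto simp: cochain_map_def cochain_ring_simps fun_eq_iff)

lemma cochain_map_cup_product:
  assumes "c \<in> cochains K Y" "d \<in> cochains K Y"
  shows "cochain_map K X g (cup_product K Y c d) =
    cup_product K X (cochain_map K X g c) (cochain_map K X g d)"
proof (intro ext)
  fix n \<sigma>
  show "cochain_map K X g (cup_product K Y c d) n \<sigma> =
    cup_product K X (cochain_map K X g c) (cochain_map K X g d) n \<sigma>"
  proof (cases "singular_simplex n X \<sigma>")
    case True
    have "c p (front_face p (simplex_map n g \<sigma>)) \<otimes> d (n - p) (back_face p (n - p) (simplex_map n g \<sigma>)) =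
      cochain_map K X g c p (front_face p \<sigma>) \<otimes> cochain_map K X g d (n - p) (back_face p (n - p) \<sigma>)"
      if "p \<le> n" for p
      using that True back_face_simplex_map[of p "n - p" g \<sigma>]
      by (simp add: cochain_map_def singular_simplex_front_face singular_simplex_back_face
          front_face_simplex_map)
    then have "cup_product K Y c d n (simplex_map n g \<sigma>) =
      cup_product K X (cochain_map K X g c) (cochain_map K X g d) n \<sigma>"
      unfolding cup_product_simplex[OF True] cup_product_simplex[OF singular_simplex_map[OF True]]
      using assms[THEN cochain_map_cochain, THEN cochain_closed] by (intro finsum_cong') auto
    then show ?thesis
      using True by (simp add: cochain_map_def[of _ _ _ "cup_product K Y c d"])
  qed (simp add: cochain_map_def cup_product_def)
qed

lemma cochain_map_coboundary:
  assumes "c \<in> cochains K Y"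
  shows "cochain_map K X g (coboundary K Y c) = coboundary K X (cochain_map K X g c)"
proof (rule coboundary_eqI[symmetric])
  fix n \<sigma>
  assume \<sigma>: "singular_simplex (Suc n) X \<sigma>"
  have "cochain_map K X g (coboundary K Y c) (Suc n) \<sigma> =
    (\<Oplus>k\<in>{..Suc n}. sgn_pow k \<otimes> c n (singular_face (Suc n) k (simplex_map (Suc n) g \<sigma>)))"
    using \<sigma> singular_simplex_map[OF \<sigma>] by (simp add: cochain_map_def coboundary_Suc del: finsum_Suc)
  also have "\<dots> = (\<Oplus>k\<in>{..Suc n}. sgn_pow k \<otimes> cochain_map K X g c n (singular_face (Suc n) k \<sigma>))"
    using \<sigma> assms by (intro finsum_cong')
      (auto simp: cochain_map_def singular_face_simplex_map_Suc singular_simplex_singular_face_Suc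
        cochain_closed)
  finally show "(\<Oplus>k\<in>{..Suc n}. sgn_pow k \<otimes> cochain_map K X g c n (singular_face (Suc n) k \<sigma>)) =
    cochain_map K X g (coboundary K Y c) (Suc n) \<sigma>" by simp
qed (simp_all add: cochain_map_def coboundary_0)

lemma cochain_map_zero: "cochain_map K X g (\<lambda>p \<sigma>. \<zero>) = (\<lambda>p \<sigma>. \<zero>)"
  by (auto simp: cochain_map_def)

lemma cochain_map_cocycle: "z \<in> cocycles K Y \<Longrightarrow> cochain_map K X g z \<in> cocycles K X"
  by (auto simp: cocycles_def cochain_map_cochain cochain_map_zero simp flip: cochain_map_coboundary)

lemma cochain_map_in_coboundaries: "b \<in> coboundaries K Y \<Longrightarrow> cochain_map K X g b \<in> coboundaries K X"
  by (auto simp: coboundaries_def cochain_map_coboundary cochain_map_cochain)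

lemma cohomology_map_class:
  assumes "z \<in> cocycles K Y"
  shows "cohomology_map K X g (cohomology_class Y z) = cohomology_class X (cochain_map K X g z)"
  unfolding cohomology_map_def
  by (rule set_add_image_cohomology_class)
    (simp_all add: assms cochain_map_cocycle cochain_map_in_coboundaries coboundaries_cocycles
      cocycle_cochain cochain_map_add)

lemma cohomology_map_carrier:
  "x \<in> carrier (cohomology K Y) \<Longrightarrow> cohomology_map K X g x \<in> carrier (cohomology K X)"
  by (auto simp: carrier_cohomology cohomology_map_class cochain_map_cocycle)

lemma cohomology_map_ring_hom: "cohomology_map K X g \<in> ring_hom (cohomology K Y) (cohomology K X)"
  by (rule ring_hom_memI)
    (auto simp: carrier_cohomology cohomology_map_class cochain_map_cocycle mult_cohomology
      add_cohomology one_cohomology unit_cocycle cup_product_cocycle add_cocycle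
      cochain_map_cup_product cochain_map_add cochain_map_unit cocycle_cochain)

lemma cohomology_map_smult:
  "r \<in> carrier K \<Longrightarrow> x \<in> carrier (cohomology K Y) \<Longrightarrow>
    cohomology_map K X g (r \<odot>\<^bsub>cohomology K Y\<^esub> x) = r \<odot>\<^bsub>cohomology K X\<^esub> cohomology_map K X g x"
  by (auto simp: carrier_cohomology cohomology_map_class cochain_map_cocycle smult_cohomology
      scale_cocycle cochain_map_scale)

lemma homogeneous_cochain_map: "homogeneous p c \<Longrightarrow> homogeneous p (cochain_map K X g c)"
  by (auto simp: homogeneous_def cochain_map_def fun_eq_iff)

lemma component_cochain_map: "component p (cochain_map K X g c) = cochain_map K X g (component p c)"
  by (auto simp: component_def cochain_map_def fun_eq_iff)

lemma cohomology_map_deg: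
  "x \<in> cohomology_deg K p Y \<Longrightarrow> cohomology_map K X g x \<in> cohomology_deg K p X"
  by (auto simp: cohomology_deg_eq cohomology_map_class cochain_map_cocycle homogeneous_cochain_map)

text \<open>Replacing a representative of \<open>y\<close> by its degree-\<open>p\<close> part gives
  the preimage; the discarded parts map to coboundaries.\<close>

lemma cohomology_map_deg_preimage:
  assumes "y \<in> carrier (cohomology K Y)" "cohomology_map K X g y \<in> cohomology_deg K p X"
  obtains y' where "y' \<in> cohomology_deg K p Y" "cohomology_map K X g y' = cohomology_map K X g y"
proof -
  obtain z where z: "z \<in> cocycles K Y" "y = cohomology_class Y z"
    using assms by (auto simp: carrier_cohomology)
  obtain w where w: "w \<in> cocycles K X" "homogeneous p w" "cohomology_map K X g y = cohomology_class X w"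
    using assms by (auto simp: cohomology_deg_eq)
  then have "cohomology_class X (cochain_map K X g z) = cohomology_class X w"
    using z by (simp add: cohomology_map_class)
  then obtain b where b: "b \<in> coboundaries K X" "cochain_map K X g z = (\<lambda>p \<sigma>. b p \<sigma> \<oplus> w p \<sigma>)"
    using cohomology_class_eq_iff z w cochain_map_cocycle by blast
  \<comment> \<open>Projecting the identity \<open>b(2)\<close> keeps \<open>w\<close>, which is
    homogeneous, and turns \<open>b\<close> into another coboundary.\<close>
  have "component p (cochain_map K X g z) = (\<lambda>q \<sigma>. component p b q \<sigma> \<oplus> component p w q \<sigma>)"
    by (auto simp: b(2) component_def fun_eq_iff)
  then have "cochain_map K X g (component p z) = (\<lambda>q \<sigma>. component p b q \<sigma> \<oplus> w q \<sigma>)"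
    using w by (simp add: component_cochain_map component_homogeneous)
  then have "cohomology_class X (cochain_map K X g (component p z)) = cohomology_class X w"
    using cohomology_class_eq_iff z w b component_cocycle cochain_map_cocycle component_coboundary by blast
  moreover have "cohomology_class Y (component p z) \<in> cohomology_deg K p Y"
    unfolding cohomology_deg_eq
    by (rule imageI) (simp add: homogeneous_component component_cocycle z(1))
  moreover have "cohomology_map K X g (cohomology_class Y (component p z)) =
      cohomology_class X (cochain_map K X g (component p z))"
    by (rule cohomology_map_class[OF component_cocycle[OF z(1)]])
  ultimately show thesis
    using w(3) that by simp
qed

end

end

section \<open>Spans and products\<close>

lemma lspan_superset: "S \<subseteq> lspan K M S"
  by (auto simp: lspan_def)

lemma lspan_least: "submodule W K M \<Longrightarrow> S \<subseteq> W \<Longrightarrow> lspan K M S \<subseteq> W"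
  by (auto simp: lspan_def)

lemma zero_in_lspan: "\<zero>\<^bsub>M\<^esub> \<in> lspan K M S"
  using subgroup.one_closed[OF submodule.axioms(1)] by (force simp: lspan_def)

text \<open>A span is an intersection of submodules, so vanishing on it follows once a kernel is
  known to be one of them. A plain function \<open>\<phi>\<close> is used so that a product with one
  variable factor fits directly.\<close>

lemma submodule_kernel:
  assumes M: "module K M" and N: "module K N"
    and closed: "\<And>x. x \<in> carrier M \<Longrightarrow> \<phi> x \<in> carrier N"
    and add: "\<And>x y. x \<in> carrier M \<Longrightarrow> y \<in> carrier M \<Longrightarrow> \<phi> (x \<oplus>\<^bsub>M\<^esub> y) = \<phi> x \<oplus>\<^bsub>N\<^esub> \<phi> y"
    and smult: "\<And>r x. r \<in> carrier K \<Longrightarrow> x \<in> carrier M \<Longrightarrow> \<phi> (r \<odot>\<^bsub>M\<^esub> x) = r \<odot>\<^bsub>N\<^esub> \<phi> x"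
  shows "submodule {x \<in> carrier M. \<phi> x = \<zero>\<^bsub>N\<^esub>} K M"
proof -
  interpret M: module K M by (rule M)
  interpret N: module K N by (rule N)
  have zero: "\<phi> \<zero>\<^bsub>M\<^esub> = \<zero>\<^bsub>N\<^esub>"
    using smult[of "\<zero>\<^bsub>K\<^esub>" "\<zero>\<^bsub>M\<^esub>"] closed[of "\<zero>\<^bsub>M\<^esub>"] by simp
  have "\<phi> (\<ominus>\<^bsub>M\<^esub> x) = \<zero>\<^bsub>N\<^esub>" if "x \<in> carrier M" "\<phi> x = \<zero>\<^bsub>N\<^esub>" for x
    using add[of "\<ominus>\<^bsub>M\<^esub> x" x] zero closed[of "\<ominus>\<^bsub>M\<^esub> x"] that by (simp add: M.M.l_neg)
  then show ?thesis
    by (intro M.submoduleI) (auto simp: zero add smult)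
qed

lemma list_product_simps [simp]:
  "list_product R [] = \<one>\<^bsub>R\<^esub>"
  "list_product R (x # xs) = x \<otimes>\<^bsub>R\<^esub> list_product R xs"
  by (simp_all add: list_product_def)

lemma list_product_carrier_update: "list_product (R\<lparr>carrier := C\<rparr>) xs = list_product R xs"
  by (simp add: list_product_def)

lemma (in ring) list_product_closed: "set xs \<subseteq> carrier R \<Longrightarrow> list_product R xs \<in> carrier R"
  by (induction xs) auto

lemma (in ring) list_product_append:
  "set xs \<subseteq> carrier R \<Longrightarrow> set ys \<subseteq> carrier R \<Longrightarrow>
    list_product R (xs @ ys) = list_product R xs \<otimes> list_product R ys"
  by (induction xs) (auto simp: list_product_closed m_assoc)

lemma (in ring) ring_hom_list_product:
  assumes "h \<in> ring_hom R S" "set xs \<subseteq> carrier R"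
  shows "h (list_product R xs) = list_product S (map h xs)"
  using assms(2)
  by (induction xs)
    (auto simp: list_product_closed ring_hom_mult[OF assms(1)] ring_hom_one[OF assms(1)])

section \<open>Products of positive-degree classes and their images\<close>

context cochain_algebra
begin

abbreviation cohomology_hom_pos :: "'a topology \<Rightarrow> ('k, 'a) cochain set set" where
  "cohomology_hom_pos X \<equiv> \<Union>p\<in>{1..}. cohomology_deg K p X"

lemma cohomology_hom_pos_carrier: "cohomology_hom_pos X \<subseteq> carrier (cohomology K X)"
  using cohomology_deg_carrier by blast

lemma cohomology_pos_carrier: "cohomology_pos K X \<subseteq> carrier (cohomology K X)"
  unfolding cohomology_pos_def
  by (rule lspan_least[OF module.carrier_is_submodule[OF cohomology_module] cohomology_hom_pos_carrier])

text \<open>The lower bound on the degree ensures that a nonempty product lands in positive degree,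
  where the graded barcode records it.\<close>

lemma list_product_deg:
  assumes "set xs \<subseteq> cohomology_hom_pos X"
  shows "\<exists>p\<ge>length xs. list_product (cohomology K X) xs \<in> cohomology_deg K p X"
  using assms
proof (induction xs)
  case Nil
  then show ?case using one_in_cohomology_deg by auto
next
  case (Cons x xs)
  then obtain p q where "p \<ge> length xs" "list_product (cohomology K X) xs \<in> cohomology_deg K p X"
    "q \<ge> 1" "x \<in> cohomology_deg K q X"
    by auto
  then show ?case
    using mult_in_cohomology_deg[of x q X] by (intro exI[of _ "q + p"]) auto
qed

lemma list_product_in_cohomology_pos_power:
  assumes "set xs \<subseteq> cohomology_hom_pos X"
  shows "list_product (cohomology K X) xs \<in> cohomology_pos_power K (length xs) X"
proof -
  have "set xs \<subseteq> cohomology_pos K X"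
    unfolding cohomology_pos_def by (rule subset_trans[OF assms lspan_superset])
  then show ?thesis
    unfolding cohomology_pos_power_def by (intro subsetD[OF lspan_superset]) auto
qed

text \<open>Two layers of spans have to be crossed: the factors are sums of homogeneous classes, and
  the elements of the power are sums of products. Each layer is a kernel argument.\<close>

lemma cohomology_map_pos_power_eq_zero:
  assumes g: "continuous_map X Y g"
    and vanish: "\<And>ys. length ys = l \<Longrightarrow> set ys \<subseteq> cohomology_hom_pos Y \<Longrightarrow>
      cohomology_map K X g (list_product (cohomology K Y) ys) = \<zero>\<^bsub>cohomology K X\<^esub>"
    and y: "y \<in> cohomology_pos_power K l Y"
  shows "cohomology_map K X g y = \<zero>\<^bsub>cohomology K X\<^esub>"
proof -
  let ?h = "cohomology_map K X g"
  interpret Y: ring "cohomology K Y" by (rule cohomology_ring)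
  interpret YM: module K "cohomology K Y" by (rule cohomology_module)
  note hom = cohomology_map_ring_hom[OF g]
  \<comment> \<open>The prefix \<open>us\<close> is already homogeneous and \<open>vs\<close> is
    still arbitrary. Leaving \<open>us\<close> free in the induction lets each factor, once made
    homogeneous, move into the prefix.\<close>
  have prod: "?h (list_product (cohomology K Y) (us @ vs)) = \<zero>\<^bsub>cohomology K X\<^esub>"
    if "set us \<subseteq> cohomology_hom_pos Y" "set vs \<subseteq> cohomology_pos K Y" "length us + length vs = l"
    for us vs
    using that
  proof (induction vs arbitrary: us)
    case Nil
    then show ?case using vanish by simp
  next
    case (Cons v vs)
    define A where "A = list_product (cohomology K Y) us"
    define B where "B = list_product (cohomology K Y) vs"
    have AB: "A \<in> carrier (cohomology K Y)" "B \<in> carrier (cohomology K Y)"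
      using Cons.prems(1,2) cohomology_hom_pos_carrier[of Y] cohomology_pos_carrier[of Y]
      unfolding A_def B_def by (auto intro!: Y.list_product_closed)
    have eq: "list_product (cohomology K Y) (us @ x # vs) = A \<otimes>\<^bsub>cohomology K Y\<^esub> (x \<otimes>\<^bsub>cohomology K Y\<^esub> B)"
      if "x \<in> carrier (cohomology K Y)" for x
      using Cons.prems cohomology_hom_pos_carrier[of Y] cohomology_pos_carrier[of Y] that
      by (subst Y.list_product_append) (auto simp: A_def B_def)
    \<comment> \<open>All factors but one are frozen. The kernel of this linear map contains the
      homogeneous classes by the induction hypothesis for \<open>us @ [x]\<close>, hence all of
      \<open>cohomology_pos\<close>.\<close>
    define \<phi> where "\<phi> x = ?h (A \<otimes>\<^bsub>cohomology K Y\<^esub> (x \<otimes>\<^bsub>cohomology K Y\<^esub> B))" for x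
    have "submodule {x \<in> carrier (cohomology K Y). \<phi> x = \<zero>\<^bsub>cohomology K X\<^esub>} K (cohomology K Y)"
      using AB unfolding \<phi>_def
      by (intro submodule_kernel cohomology_module)
        (simp_all add: cohomology_map_carrier[OF g] Y.l_distr Y.r_distr ring_hom_add[OF hom]
          smult_mult_cohomology cohomology_map_smult[OF g])
    moreover have "\<phi> x = \<zero>\<^bsub>cohomology K X\<^esub>" if "x \<in> cohomology_hom_pos Y" for x
      using Cons.IH[of "us @ [x]"] Cons.prems that eq[of x] cohomology_hom_pos_carrier[of Y]
      by (auto simp: \<phi>_def)
    ultimately have "cohomology_pos K Y \<subseteq> {x \<in> carrier (cohomology K Y). \<phi> x = \<zero>\<^bsub>cohomology K X\<^esub>}"
      unfolding cohomology_pos_def using cohomology_deg_carrier by (intro lspan_least) auto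
    then show ?case
      using Cons.prems eq[of v] by (auto simp: \<phi>_def)
  qed
  have "submodule {x \<in> carrier (cohomology K Y). ?h x = \<zero>\<^bsub>cohomology K X\<^esub>} K (cohomology K Y)"
    by (intro submodule_kernel cohomology_module)
      (simp_all add: cohomology_map_carrier[OF g] ring_hom_add[OF hom] cohomology_map_smult[OF g])
  then have "cohomology_pos_power K l Y \<subseteq> {x \<in> carrier (cohomology K Y). ?h x = \<zero>\<^bsub>cohomology K X\<^esub>}"
    unfolding cohomology_pos_power_def
  proof (rule lspan_least, intro subsetI)
    fix x assume "x \<in> {list_product (cohomology K Y) xs |xs. length xs = l \<and> set xs \<subseteq> cohomology_pos K Y}"
    then obtain xs where "x = list_product (cohomology K Y) xs" "length xs = l" "set xs \<subseteq> cohomology_pos K Y"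
      by blast
    then show "x \<in> {x \<in> carrier (cohomology K Y). ?h x = \<zero>\<^bsub>cohomology K X\<^esub>}"
      using prod[of "[]" xs] cohomology_pos_carrier[of Y] Y.list_product_closed[of xs] by auto
  qed
  then show ?thesis using y by blast
qed

definition nonzero_product_image :: "'a topology \<Rightarrow> 'b topology \<Rightarrow> ('a \<Rightarrow> 'b) \<Rightarrow> nat \<Rightarrow> bool" where
  "nonzero_product_image X Y g l \<longleftrightarrow> (\<exists>ys. length ys = l \<and> set ys \<subseteq> cohomology_hom_pos Y \<and>
    cohomology_map K X g (list_product (cohomology K Y) ys) \<noteq> \<zero>\<^bsub>cohomology K X\<^esub>)"

lemma graded_len_image:
  fixes g :: "'a \<Rightarrow> 'b"
  assumes g: "continuous_map X Y g"
  defines "im \<equiv> cohomology_map K X g ` carrier (cohomology K Y)"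
  shows "graded_len ((cohomology K X)\<lparr>carrier := im\<rparr>) (\<lambda>p. im \<inter> cohomology_deg K p X) =
    Sup {enat l |l. nonzero_product_image X Y g l}"
proof -
  let ?h = "cohomology_map K X g"
  interpret Y: ring "cohomology K Y" by (rule cohomology_ring)
  have image: "(\<Union>p\<in>{1..}. im \<inter> cohomology_deg K p X) = ?h ` cohomology_hom_pos Y"
  proof (intro equalityI subsetI)
    fix x assume "x \<in> (\<Union>p\<in>{1..}. im \<inter> cohomology_deg K p X)"
    then obtain p y where p: "p \<ge> 1" "?h y \<in> cohomology_deg K p X" and y: "y \<in> carrier (cohomology K Y)" "x = ?h y"
      by (auto simp: im_def)
    obtain y' where "y' \<in> cohomology_deg K p Y" "?h y' = ?h y"
      using cohomology_map_deg_preimage[OF g y(1) p(2)] .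
    then show "x \<in> ?h ` cohomology_hom_pos Y"
      using p y by (intro image_eqI[of _ _ y']) auto
  next
    fix x assume "x \<in> ?h ` cohomology_hom_pos Y"
    then obtain p y where "p \<ge> 1" "y \<in> cohomology_deg K p Y" "x = ?h y" by auto
    then show "x \<in> (\<Union>p\<in>{1..}. im \<inter> cohomology_deg K p X)"
      using cohomology_map_deg[OF g] cohomology_deg_carrier by (force simp: im_def)
  qed
  have "(\<exists>xs. length xs = l \<and> set xs \<subseteq> ?h ` cohomology_hom_pos Y \<and>
      list_product (cohomology K X) xs \<noteq> \<zero>\<^bsub>cohomology K X\<^esub>) \<longleftrightarrow> nonzero_product_image X Y g l"
    (is "?L \<longleftrightarrow> ?R") for l
  proof -
    have hom: "?h (list_product (cohomology K Y) ys) = list_product (cohomology K X) (map ?h ys)"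
      if "set ys \<subseteq> cohomology_hom_pos Y" for ys
      using Y.ring_hom_list_product[OF cohomology_map_ring_hom[OF g]] that cohomology_hom_pos_carrier
      by blast
    show ?thesis
    proof
      assume ?L
      \<comment> \<open>Membership in \<open>lists\<close> allows \<open>lists_image\<close> to
        choose preimages of all factors at once.\<close>
      then obtain xs where xs: "length xs = l" "xs \<in> lists (?h ` cohomology_hom_pos Y)"
        "list_product (cohomology K X) xs \<noteq> \<zero>\<^bsub>cohomology K X\<^esub>"
        by (auto simp: in_lists_conv_set)
      then obtain ys where "ys \<in> lists (cohomology_hom_pos Y)" "xs = map ?h ys"
        unfolding lists_image by blast
      then show ?R
        using xs hom[of ys] unfolding nonzero_product_image_def
        by (intro exI[of _ ys]) (simp add: lists_eq_set)
    next
      assume ?R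
      then obtain ys where "length ys = l" "set ys \<subseteq> cohomology_hom_pos Y"
        "?h (list_product (cohomology K Y) ys) \<noteq> \<zero>\<^bsub>cohomology K X\<^esub>"
        unfolding nonzero_product_image_def by blast
      then show ?L
        using hom[of ys] by (intro exI[of _ "map ?h ys"]) auto
    qed
  qed
  then show ?thesis
    unfolding graded_len_def image by (simp add: list_product_carrier_update)
qed

end

section \<open>Barcodes\<close>

context ring
begin

text \<open>Zero is recognised by \<open>z\<close> being its own double, a property that an additive
  map preserves; coordinatewise, only zero has it in the coefficient ring. This replaces a proof
  that the fibres of the module are groups.\<close>

lemma interval_sum_iso_zero:
  assumes "\<theta> \<in> iso (add_monoid N) (add_monoid (Fib (interval_sum R B) t))"
    and "z \<in> carrier N" "z \<oplus>\<^bsub>N\<^esub> z = z"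
  shows "\<theta> z = (\<lambda>j. \<zero>)"
proof
  fix j
  have "\<theta> \<in> hom (add_monoid N) (add_monoid (Fib (interval_sum R B) t))"
    using assms(1) by (simp add: iso_def)
  then have "\<theta> z \<in> carrier (Fib (interval_sum R B) t)"
    "\<theta> (z \<oplus>\<^bsub>N\<^esub> z) = \<theta> z \<oplus>\<^bsub>Fib (interval_sum R B) t\<^esub> \<theta> z"
    using assms(2) by (auto simp: hom_def)
  then have "\<theta> z j \<in> carrier R" "\<theta> z j = \<theta> z j \<oplus> \<theta> z j"
    using assms(3) by (simp_all add: interval_sum_def fun_eq_iff del: split_paired_All)
  then show "\<theta> z j = \<zero>"
    by (metis add.l_cancel_one' )
qed

text \<open>A nonzero coordinate after restriction belongs to a bar containing both \<open>s\<close>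
  and \<open>t\<close>, and convexity supplies everything between them.\<close>

lemma barcode_of_nonzero_restr:
  assumes "is_barcode R M B" "s \<le> t"
    and x: "x \<in> carrier (Fib M t)" "Restr M s t x \<in> carrier (Fib M s)"
    and nonzero: "Restr M s t x \<noteq> z"
    and z: "z \<in> carrier (Fib M s)" "z \<oplus>\<^bsub>Fib M s\<^esub> z = z"
  obtains I where "I \<in> snd ` B" "{s..t} \<subseteq> I"
proof -
  let ?S = "interval_sum R B"
  obtain \<theta> where iso: "\<And>u. \<theta> u \<in> iso (add_monoid (Fib M u)) (add_monoid (Fib ?S u))"
    and nat: "\<theta> s (Restr M s t x) = Restr ?S s t (\<theta> t x)"
    using assms unfolding is_barcode_def pmodule_iso_def by blast
  have "inj_on (\<theta> s) (carrier (Fib M s))"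
    using iso[of s] by (simp add: iso_def bij_betw_def)
  moreover have "\<theta> s z = (\<lambda>j. \<zero>)"
    using interval_sum_iso_zero[OF iso z] .
  ultimately have "Restr ?S s t (\<theta> t x) \<noteq> (\<lambda>j. \<zero>)"
    using nonzero x z nat unfolding inj_on_def by metis
  then obtain j where j: "s \<in> snd j" "t \<in> snd j" "\<theta> t x j \<noteq> \<zero>"
    by (auto simp: interval_sum_def fun_eq_iff split: if_splits)
  have "\<theta> t x \<in> carrier (Fib ?S t)"
    using iso[of t] x by (auto simp: iso_def hom_def)
  then have "j \<in> B"
    using j by (simp add: interval_sum_def del: split_paired_All)
  then have "is_interval (snd j)"
    using assms(1) by (auto simp: is_barcode_def)
  then have "{s..t} \<subseteq> snd j"
    using j(1,2) mem_is_interval_1_I[of "snd j" s t] by (intro subsetI) simp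
  with \<open>j \<in> B\<close> show thesis using that[of "snd j"] by simp
qed

lemma nonzero_restr_of_barcode:
  assumes "\<one> \<noteq> \<zero>" "is_barcode R M B" "s \<le> t"
    and I: "I \<in> snd ` B" "{s..t} \<subseteq> I"
    and z: "z \<in> carrier (Fib M s)" "z \<oplus>\<^bsub>Fib M s\<^esub> z = z"
  obtains x where "x \<in> carrier (Fib M t)" "Restr M s t x \<noteq> z"
proof -
  let ?S = "interval_sum R B"
  obtain \<theta> where iso: "\<And>u. \<theta> u \<in> iso (add_monoid (Fib M u)) (add_monoid (Fib ?S u))"
    and nat: "\<And>x. x \<in> carrier (Fib M t) \<Longrightarrow> \<theta> s (Restr M s t x) = Restr ?S s t (\<theta> t x)"
    using assms unfolding is_barcode_def pmodule_iso_def by blast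
  obtain j where j: "j \<in> B" "s \<in> snd j" "t \<in> snd j"
    using I \<open>s \<le> t\<close> by (force simp: subset_iff)
  \<comment> \<open>The generator of the interval module of the bar \<open>j\<close>: it exists at
    \<open>t\<close> and survives to \<open>s\<close> because the bar contains both points.\<close>
  define e where "e k = (if k = j then \<one> else \<zero>)" for k
  have "e \<in> carrier (Fib ?S t)"
    using j by (auto simp: interval_sum_def e_def)
  moreover have "bij_betw (\<theta> t) (carrier (Fib M t)) (carrier (Fib ?S t))"
    using iso[of t] by (simp add: iso_def)
  ultimately obtain x where x: "x \<in> carrier (Fib M t)" "\<theta> t x = e"
    by (metis bij_betw_imp_surj_on imageE)
  have "Restr ?S s t e j \<noteq> \<zero>"
    using j \<open>\<one> \<noteq> \<zero>\<close> by (simp add: interval_sum_def e_def)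
  then have "\<theta> s (Restr M s t x) \<noteq> \<theta> s z"
    using nat[OF x(1)] x(2) interval_sum_iso_zero[OF iso z] by auto
  then show thesis using that x by blast
qed

end

section \<open>Comparison of the two suprema\<close>

theorem proposition4p15:
  fixes K :: "('k, 'm) ring_scheme"
    and X :: "'a pspace"
    and barc :: "nat \<Rightarrow> (nat \<times> 'i) bars"
    and \<tau> :: bar_type
    and a b :: real
  assumes "field K"
    and "persistent_space X"
    and "discrete (critical_values K X)"
    and "q_tame K X"
    and "\<And>l. l \<ge> 1 \<Longrightarrow> is_graded_barcode K (cup_module K X l) (barc l)"
    and "\<And>l I. l \<ge> 1 \<Longrightarrow> I \<in> snd ` barc l \<Longrightarrow> \<exists>c d. I = bar \<tau> c d"
    and "a \<le> b"
  shows "pcup_length K X a b =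
    (SUP I \<in> {bar \<tau> c d |c d. {a..b} \<subseteq> bar \<tau> c d}. SUP l \<in> {l. l \<ge> 1 \<and> I \<in> snd ` barc l}. enat l)"
proof -
  interpret F: field K by (rule assms)
  interpret cochain_algebra K by (simp add: cochain_algebra_def F.is_cring)
  let ?Xa = "Space X a" and ?Xb = "Space X b" and ?g = "Map X a b"
  have g: "continuous_map ?Xa ?Xb ?g"
    using assms(2,7) by (auto simp: persistent_space_def)
  interpret Ha: ring "cohomology K ?Xa" by (rule cohomology_ring)
  interpret Hb: ring "cohomology K ?Xb" by (rule cohomology_ring)
  have bars: "nonzero_product_image ?Xa ?Xb ?g l \<longleftrightarrow> (\<exists>I\<in>snd ` barc l. {a..b} \<subseteq> I)"
    if l: "l \<ge> 1" for l
  proof -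
    obtain B where B: "\<And>p. p \<ge> 1 \<Longrightarrow> is_barcode K (cup_module K X l p) (B p)"
      and barc: "barc l = {((p, i), I) |p i I. p \<ge> 1 \<and> (i, I) \<in> B p}"
      using assms(5)[OF l] unfolding is_graded_barcode_def by blast
    have snd_barc: "snd ` barc l = (\<Union>p\<in>{1..}. snd ` B p)"
      unfolding barc by force
    \<comment> \<open>The zero class serves as the self-doubling element \<open>z\<close> of the
      barcode lemmas, in every degree \<open>p\<close>.\<close>
    have zero: "\<zero>\<^bsub>cohomology K ?Xa\<^esub> \<in> carrier (Fib (cup_module K X l p) a)"
      "\<zero>\<^bsub>cohomology K ?Xa\<^esub> \<oplus>\<^bsub>Fib (cup_module K X l p) a\<^esub> \<zero>\<^bsub>cohomology K ?Xa\<^esub> = \<zero>\<^bsub>cohomology K ?Xa\<^esub>"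
      for p
      by (simp_all add: cup_module_def zero_in_cohomology_deg cohomology_pos_power_def zero_in_lspan)
    show ?thesis
    proof
      assume "nonzero_product_image ?Xa ?Xb ?g l"
      then obtain ys where ys: "length ys = l" "set ys \<subseteq> cohomology_hom_pos ?Xb"
        "cohomology_map K ?Xa ?g (list_product (cohomology K ?Xb) ys) \<noteq> \<zero>\<^bsub>cohomology K ?Xa\<^esub>"
        unfolding nonzero_product_image_def by blast
      let ?y = "list_product (cohomology K ?Xb) ys"
      let ?xs = "map (cohomology_map K ?Xa ?g) ys"
      obtain p where p: "p \<ge> 1" "?y \<in> cohomology_deg K p ?Xb"
        using list_product_deg[OF ys(2)] l ys(1) le_trans by blast
      have "cohomology_map K ?Xa ?g ?y = list_product (cohomology K ?Xa) ?xs"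
        using Hb.ring_hom_list_product[OF cohomology_map_ring_hom[OF g]] ys(2) cohomology_hom_pos_carrier
        by blast
      moreover have "set ?xs \<subseteq> cohomology_hom_pos ?Xa"
        using ys(2) cohomology_map_deg[OF g] by fastforce
      \<comment> \<open>The image must itself lie in the fibre at \<open>a\<close>; it does, being a
        product of \<open>l\<close> homogeneous classes there.\<close>
      ultimately have "cohomology_map K ?Xa ?g ?y \<in> cohomology_pos_power K l ?Xa"
        using list_product_in_cohomology_pos_power[of ?xs] ys(1) by simp
      then have "Restr (cup_module K X l p) a b ?y \<in> carrier (Fib (cup_module K X l p) a)"
        using cohomology_map_deg[OF g p(2)] by (simp add: cup_module_def)
      moreover have "?y \<in> carrier (Fib (cup_module K X l p) b)"
        using list_product_in_cohomology_pos_power[OF ys(2)] p(2) ys(1) by (simp add: cup_module_def)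
      moreover have "Restr (cup_module K X l p) a b ?y \<noteq> \<zero>\<^bsub>cohomology K ?Xa\<^esub>"
        using ys(3) by (simp add: cup_module_def)
      ultimately obtain I where "I \<in> snd ` B p" "{a..b} \<subseteq> I"
        using F.barcode_of_nonzero_restr[OF B[OF p(1)] assms(7) _ _ _ zero] by metis
      then show "\<exists>I\<in>snd ` barc l. {a..b} \<subseteq> I"
        using p unfolding snd_barc by blast
    next
      assume "\<exists>I\<in>snd ` barc l. {a..b} \<subseteq> I"
      then obtain I p where p: "p \<ge> 1" "I \<in> snd ` B p" "{a..b} \<subseteq> I"
        unfolding snd_barc by auto
      obtain x where "x \<in> carrier (Fib (cup_module K X l p) b)"
        "Restr (cup_module K X l p) a b x \<noteq> \<zero>\<^bsub>cohomology K ?Xa\<^esub>"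
        using F.nonzero_restr_of_barcode[OF F.one_not_zero B[OF p(1)] assms(7) p(2,3) zero] .
      \<comment> \<open>If all products of homogeneous classes had zero image, the structure map
        would vanish on the whole power, contrary to the choice of \<open>x\<close>.\<close>
      then show "nonzero_product_image ?Xa ?Xb ?g l"
        using cohomology_map_pos_power_eq_zero[OF g, of l x]
        by (auto simp: cup_module_def nonzero_product_image_def)
    qed
  qed
  have "pcup_length K X a b = Sup {enat l |l. nonzero_product_image ?Xa ?Xb ?g l}"
    unfolding pcup_length_def Let_def by (rule graded_len_image[OF g])
  also have "\<dots> =
    (SUP I \<in> {bar \<tau> c d |c d. {a..b} \<subseteq> bar \<tau> c d}. SUP l \<in> {l. l \<ge> 1 \<and> I \<in> snd ` barc l}. enat l)"
  proof (rule antisym)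
    show "Sup {enat l |l. nonzero_product_image ?Xa ?Xb ?g l} \<le>
      (SUP I \<in> {bar \<tau> c d |c d. {a..b} \<subseteq> bar \<tau> c d}. SUP l \<in> {l. l \<ge> 1 \<and> I \<in> snd ` barc l}. enat l)"
      (is "_ \<le> ?rhs")
    proof (rule Sup_least)
      fix n assume "n \<in> {enat l |l. nonzero_product_image ?Xa ?Xb ?g l}"
      then obtain l where l: "n = enat l" "nonzero_product_image ?Xa ?Xb ?g l" by blast
      show "n \<le> ?rhs"
      \<comment> \<open>The empty product may be nonzero, but no bar is counted for length 0; its
        contribution 0 lies below any supremum.\<close>
      proof (cases "l = 0")
        case True
        then show ?thesis by (simp add: l(1) flip: zero_enat_def)
      next
        case False
        then obtain I where "I \<in> snd ` barc l" "{a..b} \<subseteq> I"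
          using bars[of l] l(2) by auto
        \<comment> \<open>The common type of the bars puts \<open>I\<close> into the index set of
          the outer supremum.\<close>
        then show ?thesis
          using False assms(6)[of l I] unfolding l(1)
          by (intro SUP_upper2[of I] SUP_upper) auto
      qed
    qed
    show "?rhs \<le> Sup {enat l |l. nonzero_product_image ?Xa ?Xb ?g l}"
    proof (intro SUP_least Sup_upper)
      fix I l
      assume "I \<in> {bar \<tau> c d |c d. {a..b} \<subseteq> bar \<tau> c d}" "l \<in> {l. l \<ge> 1 \<and> I \<in> snd ` barc l}"
      then have "l \<ge> 1" "I \<in> snd ` barc l" "{a..b} \<subseteq> I" by auto
      then show "enat l \<in> {enat l |l. nonzero_product_image ?Xa ?Xb ?g l}"
        using bars by blast
    qed
  qed
  finally show ?thesis .
qed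

end
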